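(* Let $a\in(1,\infty)\setminus\mathbb N$ and let $P^\lambda=\partial_x+(|y|^{a+1}+\lambda)\partial_y$ on $\mathbb R^2\ni(x,y)$. Then the equation $P^\lambda N^\lambda=0$ does not admit solutions $N^\lambda$ defined in a neighborhood of the origin in $\mathbb R^2$ that satisfy $$dN^\lambda(0)\ne0,\qquad \{N^\lambda\}\in\mathcal C^{b,1}_*,\qquad b>a.$$ That is, there are no $b>a$, no bounded neighborhood $D$ of the origin, and no family $\{N^\lambda\}_{\lambda\in[0,1]}\in\mathcal C_*^{b,1}(\overline D)$ with $P^\lambda N^\lambda=0$ in $D$ and $dN^\lambda(0)\neq0$ for all $\lambda$. In particular, for $b>a$ there does not exist a real analytic family of $\mathcal C^b$ diffeomorphisms, defined near the origin, that transform $P^\lambda$ into $\partial_{\hat x}$.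
   Context: For $k,j\in\mathbb N=\{0,1,\dots\}$, $\alpha,\beta\in[0,1)$, a bounded domain $D$ and $I=[0,1]$, $\mathcal C_*^{k+\alpha,j+\beta}(\overline D)$ is the set of families $\{u^\lambda\}_{\lambda\in I}$ of functions on $\overline D$ such that, for all $m\le k$ and $i\le j$, all derivatives $\partial^m\partial_\lambda^iu^\lambda$ (of order $m$ in the space variables and $i$ in $\lambda$) are continuous on $\overline D\times I$, have $\mathcal C^\alpha(\overline D)$-norms bounded uniformly in $\lambda\in I$, and $\mathcal C^\beta(I)$-norms bounded uniformly in the space variables. A diffeomorphism $F$ transforms a vector field $P$ into $\partial_{\hat x}$ if $F_*P=\partial_{\hat x}$, where $(\hat x,\hat y)$ are the standard coordinates on the target. "Real analytic family of $\mathcal C^b$ diffeomorphisms" means that $F^\lambda$ depends real analytically on $\lambda$ as a map into $\mathcal C^b$ of a neighborhood of the origin. *)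

theory Defs
  imports "HOL-Analysis.Analysis"
begin

section \<open>Hoelder norms and spaces\<close>

definition holder_norm ::
  "real \<Rightarrow> 'a::metric_space set \<Rightarrow> ('a \<Rightarrow> 'b::real_normed_vector) \<Rightarrow> ennreal" where
  "holder_norm \<alpha> S f =
     (SUP x\<in>S. ennreal (norm (f x))) +
     (if \<alpha> = 0 then 0
      else (SUP (x, y)\<in>{(x, y). x \<in> S \<and> y \<in> S \<and> x \<noteq> y}.
              ennreal (norm (f x - f y) / dist x y powr \<alpha>)))"

text \<open>The partial derivative of \<open>f\<close> along a word of coordinate directions (elements of
  \<^const>\<open>Basis\<close>); the length of the word is the order of the derivative.\<close>

fun iter_partial :: "'a list \<Rightarrow> ('a::euclidean_space \<Rightarrow> 'b::real_normed_vector) \<Rightarrow> 'a \<Rightarrow> 'b" where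
  "iter_partial [] f = f"
| "iter_partial (e # es) f = (\<lambda>p. frechet_derivative (iter_partial es f) (at p) e)"

definition multi_dirs :: "nat \<Rightarrow> 'a::euclidean_space list set" where
  "multi_dirs k = {w. set w \<subseteq> Basis \<and> length w \<le> k}"

text \<open>The space of functions of class \<open>C\<close> to the \<open>b\<close> on the closure of an open set \<open>D\<close>, where
  \<open>b = k + \<alpha>\<close> with \<open>k\<close> the integer part and \<open>\<alpha>\<close> the fractional part of \<open>b\<close>.
  The derivatives are taken in \<open>D\<close>; their continuous extension \<open>g\<close> to the closure is unique.\<close>

definition holder_space ::
  "real \<Rightarrow> 'a::euclidean_space set \<Rightarrow> ('a \<Rightarrow> 'b::real_normed_vector) set" where
  "holder_space b D = {f.
     continuous_on (closure D) f \<and>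
     (\<forall>w\<in>multi_dirs (nat \<lfloor>b\<rfloor>). length w < nat \<lfloor>b\<rfloor> \<longrightarrow> iter_partial w f differentiable_on D) \<and>
     (\<forall>w\<in>multi_dirs (nat \<lfloor>b\<rfloor>). \<exists>g.
        continuous_on (closure D) g \<and>
        (\<forall>p\<in>D. g p = iter_partial w f p) \<and>
        holder_norm (frac b) (closure D) g < \<infinity>)}"

text \<open>Taking the suprema over \<open>D\<close> instead of its closure gives the same value on
  \<open>holder_space b D\<close>.\<close>

definition holder_space_norm ::
  "real \<Rightarrow> 'a::euclidean_space set \<Rightarrow> ('a \<Rightarrow> 'b::real_normed_vector) \<Rightarrow> ennreal" where
  "holder_space_norm b D f =
     (SUP w\<in>multi_dirs (nat \<lfloor>b\<rfloor>). holder_norm (frac b) D (iter_partial w f))"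

definition locally_holder ::
  "real \<Rightarrow> 'a::euclidean_space set \<Rightarrow> ('a \<Rightarrow> 'b::real_normed_vector) \<Rightarrow> bool" where
  "locally_holder b U f \<longleftrightarrow> (\<forall>p\<in>U. \<exists>r>0. ball p r \<subseteq> U \<and> f \<in> holder_space b (ball p r))"

section \<open>Families depending on a parameter in the unit interval\<close>

text \<open>At the endpoints of the interval the derivatives in the parameter are one-sided.\<close>

fun param_deriv :: "nat \<Rightarrow> (real \<Rightarrow> 'a \<Rightarrow> 'b::real_normed_vector) \<Rightarrow> real \<Rightarrow> 'a \<Rightarrow> 'b" where
  "param_deriv 0 u = u"
| "param_deriv (Suc i) u =
     (\<lambda>l p. vector_derivative (\<lambda>s. param_deriv i u s p) (at l within {0..1}))"

text \<open>The class of families with regularity \<open>b = k + \<alpha>\<close> in space and \<open>c = j + \<beta>\<close> in the parameter,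
  with \<open>\<alpha>\<close> and \<open>\<beta>\<close> in \<open>[0,1)\<close>.  As above, \<open>g\<close> is the continuous extension to the closure of the
  derivative of order \<open>length w\<close> in space and \<open>i\<close> in the parameter.\<close>

definition C_star ::
  "real \<Rightarrow> real \<Rightarrow> 'a::euclidean_space set \<Rightarrow> (real \<Rightarrow> 'a \<Rightarrow> 'b::real_normed_vector) set" where
  "C_star b c D = {u.
     (\<forall>i < nat \<lfloor>c\<rfloor>. \<forall>p\<in>closure D. \<forall>l\<in>{0..1}.
        (\<lambda>s. param_deriv i u s p) differentiable (at l within {0..1})) \<and>
     (\<forall>i \<le> nat \<lfloor>c\<rfloor>. continuous_on (closure D \<times> {0..1}) (\<lambda>(p, l). param_deriv i u l p)) \<and>
     (\<forall>i \<le> nat \<lfloor>c\<rfloor>. \<forall>w\<in>multi_dirs (nat \<lfloor>b\<rfloor>). length w < nat \<lfloor>b\<rfloor> \<longrightarrow>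
        (\<forall>l\<in>{0..1}. iter_partial w (param_deriv i u l) differentiable_on D)) \<and>
     (\<forall>i \<le> nat \<lfloor>c\<rfloor>. \<forall>w\<in>multi_dirs (nat \<lfloor>b\<rfloor>). \<exists>g :: real \<Rightarrow> 'a \<Rightarrow> 'b.
        continuous_on (closure D \<times> {0..1}) (\<lambda>(p, l). g l p) \<and>
        (\<forall>l\<in>{0..1}. \<forall>p\<in>D. g l p = iter_partial w (param_deriv i u l) p) \<and>
        (\<exists>C. \<forall>l\<in>{0..1}. holder_norm (frac b) (closure D) (g l) \<le> ennreal C) \<and>
        (\<exists>C. \<forall>p\<in>closure D. holder_norm (frac c) {0..1} (\<lambda>l. g l p) \<le> ennreal C))}"

text \<open>Real analyticity on the unit interval of a map into the Banach space \<open>holder_space b D\<close>: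
  near every parameter value (relative to the interval) it is the sum of a power series converging
  in the norm of that space.\<close>

definition analytic_family ::
  "real \<Rightarrow> 'a::euclidean_space set \<Rightarrow> (real \<Rightarrow> 'a \<Rightarrow> 'b::real_normed_vector) \<Rightarrow> bool" where
  "analytic_family b D F \<longleftrightarrow>
     (\<forall>l\<in>{0..1}. F l \<in> holder_space b D) \<and>
     (\<forall>l0\<in>{0..1}. \<exists>r>0. \<exists>c :: nat \<Rightarrow> 'a \<Rightarrow> 'b.
        (\<forall>n. c n \<in> holder_space b D) \<and>
        (\<forall>l\<in>{0..1}. \<bar>l - l0\<bar> < r \<longrightarrow>
           (\<lambda>n. holder_space_norm b D (\<lambda>p. F l p - (\<Sum>i<n. (l - l0) ^ i *\<^sub>R c i p))) \<longlonglongrightarrow> 0))"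

section \<open>Vector fields and diffeomorphisms\<close>

definition vf_apply ::
  "('a::real_normed_vector \<Rightarrow> 'a) \<Rightarrow> ('a \<Rightarrow> 'b::real_normed_vector) \<Rightarrow> 'a \<Rightarrow> 'b" where
  "vf_apply X f p = frechet_derivative f (at p) (X p)"

definition pushforward ::
  "'a set \<Rightarrow> ('a::real_normed_vector \<Rightarrow> 'b::real_normed_vector) \<Rightarrow> ('a \<Rightarrow> 'a) \<Rightarrow> 'b \<Rightarrow> 'b" where
  "pushforward D F X q = vf_apply X F (inv_into D F q)"

definition holder_diffeo ::
  "real \<Rightarrow> 'a::euclidean_space set \<Rightarrow> ('a \<Rightarrow> 'a) \<Rightarrow> bool" where
  "holder_diffeo b D F \<longleftrightarrow>
     inj_on F D \<and> open (F ` D) \<and> locally_holder b D F \<and> locally_holder b (F ` D) (inv_into D F)"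

definition bounded_domain :: "'a::metric_space set \<Rightarrow> bool" where
  "bounded_domain D \<longleftrightarrow> open D \<and> connected D \<and> D \<noteq> {} \<and> bounded D"

text \<open>A vector field is given by its coefficients with respect to the coordinate fields of the
  plane, so the first coordinate field is the constant \<open>(1, 0)\<close>.\<close>

definition P_field :: "real \<Rightarrow> real \<Rightarrow> real \<times> real \<Rightarrow> real \<times> real" where
  "P_field a l = (\<lambda>(x, y). (1, \<bar>y\<bar> powr (a + 1) + l))"

end

(* Put v = d/dl u at l = 0 and integrate the equation of the difference quotient (u_l - u_0)/l in y
   from 0 to y.  An integration by parts absorbs the y-derivative of the quotient, on which there is no
   uniform bound, and leaves a term that is o(y^(a+1)).  In the limit, the second difference in x of the
   integral of v over [0, y] is X^2 A y^(a+1) + o(y^(a+1)), where X is the step and A is the y-derivative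
   of u_0 at the origin.  If v is of class C^b with b > a, Taylor's formula shows that this second
   difference is also a polynomial of degree less than a + 1, up to o(y^(a+1)).  As a + 1 is not an
   integer, A = 0, and then the equation at the origin gives du_0 = 0. *)

theory Submission
  imports Defs
begin

text \<open>Both claims are the equation \<open>vf_apply (P_field a l) (u l) p = e\<close>, with
  \<open>e = 0\<close> for \<open>N\<close> and \<open>e = (1, 0)\<close> for \<open>F\<close>. For
  a diffeomorphism the contradiction is that its derivative kills \<open>(0, 1)\<close>.
  Heuristically: subtracting the equations at \<open>l\<close> and 0 and dividing by
  \<open>l\<close> gives w_x + y^(a+1) w_y = -u_y for the quotient w, with u_y taken at
  \<open>l\<close>. At parameter 0, u contains -x A y^(a+1), so u_y contains -(a+1) x A y^a and v
  must contain (a+1) (x^2/2) A y^a. This is the singularity that b > a forbids. The equation is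
  integrated in y because u_y is only known to be continuous, while u itself has a usable expansion.
  The price is the term u_0(0,y) - u_0(0,0), whose C^b regularity need not reach the order y^(a+1).
  It does not depend on x, so it contributes to the integral of v only a term linear in x; this is
  what the second difference is for. The parameter enters only through uniform convergence of the
  quotients to a v of class C^b, which both kinds of families provide. All estimates live on a
  square in the first quadrant, where |y| = y.\<close>

section \<open>Powers, polynomials and Taylor remainders to the right of zero\<close>

lemma powr_diff_tendsto_0_at_right:
  fixes p q :: real
  assumes "p < q"
  shows "((\<lambda>t. t powr (q - p)) \<longlongrightarrow> 0) (at_right 0)"
proof -
  have "((\<lambda>t::real. t powr (q - p)) \<longlongrightarrow> 0 powr (q - p)) (at_right 0)"
    using assms by (intro tendsto_powr2 tendsto_intros)
      (auto simp: eventually_at_right_less order.strict_implies_order eventually_at_filter)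
  then show ?thesis by simp
qed

text \<open>The coefficients vanish from the lowest upwards: multiplying the quotient by
  \<open>t powr (s - real i)\<close>, which tends to 0, leaves the polynomial divided by
  \<open>t ^ i\<close>, and once the lower coefficients are gone this tends to \<open>d i\<close>.
  The quotient is then identically 0. In the application the strict inequality
  \<open>real m < s\<close> is where the non-integrality of \<open>a\<close> enters.\<close>

lemma polynomial_not_asymp_noninteger_power:
  fixes d :: "nat \<Rightarrow> 'v::real_normed_vector" and B :: 'v and s :: real
  assumes s: "real m < s"
    and lim: "((\<lambda>t. (\<Sum>i\<le>m. t ^ i *\<^sub>R d i) /\<^sub>R t powr s) \<longlongrightarrow> B) (at_right 0)"
  shows "B = 0"
proof -
  have "d i = 0" if "i \<le> m" for i
    using that
  proof (induction i rule: less_induct)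
    case (less i)
    have 1: "((\<lambda>t. t powr (s - real i) *\<^sub>R ((\<Sum>j\<le>m. t ^ j *\<^sub>R d j) /\<^sub>R t powr s)) \<longlongrightarrow> 0 *\<^sub>R B) (at_right 0)"
      using less.prems s by (intro tendsto_scaleR lim powr_diff_tendsto_0_at_right) auto
    have 2: "((\<lambda>t::real. \<Sum>j\<le>m. if j < i then 0 else t ^ (j - i) *\<^sub>R d j) \<longlongrightarrow>
               (\<Sum>j\<le>m. if j < i then 0 else 0 ^ (j - i) *\<^sub>R d j)) (at_right 0)"
      by (auto intro!: tendsto_intros)
    have "(\<Sum>j\<le>m. if j < i then 0 else (0::real) ^ (j - i) *\<^sub>R d j) = (\<Sum>j\<le>m. if j = i then d j else 0)"
      by (intro sum.cong) (auto simp: power_0_left)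
    also have "\<dots> = d i" using less.prems by simp
    finally have 3: "(\<Sum>j\<le>m. if j < i then 0 else (0::real) ^ (j - i) *\<^sub>R d j) = d i" .
    have "t powr (s - real i) *\<^sub>R ((\<Sum>j\<le>m. t ^ j *\<^sub>R d j) /\<^sub>R t powr s)
            = (\<Sum>j\<le>m. if j < i then 0 else t ^ (j - i) *\<^sub>R d j)" if "t > 0" for t :: real
    proof -
      have "t powr (s - real i) *\<^sub>R ((\<Sum>j\<le>m. t ^ j *\<^sub>R d j) /\<^sub>R t powr s)
         = (\<Sum>j\<le>m. (t ^ j / t ^ i) *\<^sub>R d j)"
        using that by (simp add: powr_diff powr_realpow scaleR_sum_right field_simps)
      also have "\<dots> = (\<Sum>j\<le>m. if j < i then 0 else t ^ (j - i) *\<^sub>R d j)"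
        using less that by (intro sum.cong) (auto simp: power_diff)
      finally show ?thesis .
    qed
    then have "\<forall>\<^sub>F t in at_right 0. t powr (s - real i) *\<^sub>R ((\<Sum>j\<le>m. t ^ j *\<^sub>R d j) /\<^sub>R t powr s)
            = (\<Sum>j\<le>m. if j < i then 0 else t ^ (j - i) *\<^sub>R d j)"
      by (auto simp: eventually_at_filter)
    with 1 have "((\<lambda>t::real. \<Sum>j\<le>m. if j < i then 0 else t ^ (j - i) *\<^sub>R d j) \<longlongrightarrow> 0 *\<^sub>R B) (at_right 0)"
      by (rule Lim_transform_eventually)
    from tendsto_unique[OF _ 2 this] 3 show ?case by simp
  qed
  then have "((\<lambda>t::real. 0::'v) \<longlongrightarrow> B) (at_right 0)"
    using lim by simp
  then show ?thesis by (simp add: tendsto_const_iff)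
qed

text \<open>The derivative of the remainder of \<open>f 0\<close> is the remainder, one order lower,
  of the shifted sequence \<open>f 1\<close>, \<open>f 2\<close>, ..., so the mean value inequality
  on \<open>{0..t}\<close> gains one factor \<open>t\<close> in each induction step. Bounding the
  derivative by its bound at the right end keeps the constant \<open>C\<close> unchanged. Being an
  inequality of norms, the argument also works for vector values.\<close>

lemma taylor_holder_remainder:
  fixes f :: "nat \<Rightarrow> real \<Rightarrow> 'v::real_normed_vector"
  assumes "\<And>i t. \<lbrakk>i < k; t \<in> {0..\<rho>}\<rbrakk> \<Longrightarrow> (f i has_vector_derivative f (Suc i) t) (at t)"
    and "\<And>t. t \<in> {0..\<rho>} \<Longrightarrow> norm (f k t - f k 0) \<le> C * t powr \<sigma>"
    and "\<sigma> > 0" "C \<ge> 0" "t \<in> {0<..\<rho>}"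
  shows "norm (f 0 t - (\<Sum>i\<le>k. (t ^ i / fact i) *\<^sub>R f i 0)) \<le> C * t powr (\<sigma> + real k)"
  using assms
proof (induction k arbitrary: f t)
  case 0
  then show ?case by simp
next
  case (Suc k)
  let ?R = "\<lambda>t. f 0 t - (\<Sum>i\<le>Suc k. (t ^ i / fact i) *\<^sub>R f i 0)"
  let ?R' = "\<lambda>t. f 1 t - (\<Sum>i\<le>k. (t ^ i / fact i) *\<^sub>R f (Suc i) 0)"
  let ?M = "C * t powr (\<sigma> + real k)"
  have IH: "norm (?R' s) \<le> C * s powr (\<sigma> + real k)" if "s \<in> {0<..\<rho>}" for s
    using Suc.IH[of "\<lambda>i. f (Suc i)" s] Suc.prems that by simp
  have R0: "?R 0 = 0" by (simp add: sum.atMost_Suc_shift del: sum.atMost_Suc)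
  have der: "(?R has_vector_derivative ?R' s) (at s)" if "s \<in> {0..\<rho>}" for s
  proof -
    have "((\<lambda>t. \<Sum>i\<le>Suc k. (t ^ i / fact i) *\<^sub>R f i 0) has_vector_derivative
            (\<Sum>i\<le>Suc k. (real i * s ^ (i - 1) / fact i) *\<^sub>R f i 0)) (at s)"
    proof (rule has_vector_derivative_sum)
      fix i
      have "((\<lambda>t. t ^ i / fact i) has_real_derivative real i * s ^ (i - 1) / fact i) (at s)"
        by (auto intro!: derivative_eq_intros)
      then show "((\<lambda>t. (t ^ i / fact i) *\<^sub>R f i 0) has_vector_derivative
          (real i * s ^ (i - 1) / fact i) *\<^sub>R f i 0) (at s)"
        using has_vector_derivative_scaleR[OF _ has_vector_derivative_const[of "f i 0"]] by fastforce
    qed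
    also have "(\<Sum>i\<le>Suc k. (real i * s ^ (i - 1) / fact i) *\<^sub>R f i 0)
              = (\<Sum>i\<le>k. (s ^ i / fact i) *\<^sub>R f (Suc i) 0)"
    proof -
      have "real (Suc j) * s ^ j / fact (Suc j) = s ^ j / fact j" for j
        by (simp del: of_nat_Suc)
      then show ?thesis
        by (simp add: sum.atMost_Suc_shift del: sum.atMost_Suc fact_Suc of_nat_Suc)
    qed
    finally show ?thesis
      using Suc.prems(1)[of 0 s] that by (auto intro!: derivative_intros)
  qed
  have t: "0 < t" "t \<le> \<rho>" using Suc.prems by auto
  have "norm (?R t - ?R 0) \<le> ?M * t - ?M * 0"
  proof (rule differentiable_bound_general[where f = ?R and f' = ?R' and \<phi>' = "\<lambda>_. ?M"])
    show "continuous_on {0..t} ?R"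
      using t by (intro continuous_at_imp_continuous_on ballI has_vector_derivative_continuous[OF der]) auto
    show "(?R has_vector_derivative ?R' x) (at x)" if "0 < x" "x < t" for x
      using der that t by auto
    show "((*) ?M has_vector_derivative ?M) (at x)" for x
      by (auto intro!: derivative_eq_intros simp flip: has_real_derivative_iff_has_vector_derivative)
    show "norm (?R' x) \<le> ?M" if "0 < x" "x < t" for x
    proof -
      have "norm (?R' x) \<le> C * x powr (\<sigma> + real k)" using IH that t by auto
      also have "\<dots> \<le> ?M" using that Suc.prems by (intro mult_left_mono powr_mono2) auto
      finally show ?thesis .
    qed
  qed (use t in \<open>auto intro!: continuous_intros\<close>)
  then show ?case using R0 t by (simp add: powr_add powr_realpow algebra_simps del: sum.atMost_Suc)
qed

section \<open>The transport equation integrated in the normal variable\<close>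

text \<open>Integration by parts is done with \<open>w t - w Y\<close> in place of
  \<open>w t\<close>: the boundary terms vanish at 0 because of the weight and at \<open>Y\<close>
  because of the subtraction. Only the oscillation \<open>\<eta>\<close> of \<open>w\<close> is
  left, and \<open>(a + 1) * t powr a\<close> integrates to exactly \<open>Y powr (a + 1)\<close>.
  Integrability of the weighted \<open>wy\<close> is a by-product of the fundamental theorem, so
  \<open>wy\<close> may be discontinuous.\<close>

lemma weighted_integral_bound:
  fixes w wy :: "real \<Rightarrow> 'v::euclidean_space"
  assumes a: "a > 0" and Y: "0 \<le> Y"
    and der: "\<And>t. t \<in> {0..Y} \<Longrightarrow> (w has_vector_derivative wy t) (at t within {0..Y})"
    and osc: "\<And>t. t \<in> {0..Y} \<Longrightarrow> norm (w Y - w t) \<le> \<eta>"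
  shows "(\<lambda>t. t powr (a + 1) *\<^sub>R wy t) integrable_on {0..Y}"
    and "norm (integral {0..Y} (\<lambda>t. t powr (a + 1) *\<^sub>R wy t)) \<le> \<eta> * Y powr (a + 1)"
proof -
  let ?g = "\<lambda>t. t powr (a + 1) *\<^sub>R (w t - w Y)"
  let ?q = "\<lambda>t. ((a + 1) * t powr a) *\<^sub>R (w t - w Y)"
  have cw: "continuous_on {0..Y} w"
    using der by (meson continuous_on_eq_continuous_within has_vector_derivative_continuous)
  have cp: "continuous_on {0..Y} (\<lambda>t. t powr c)" if "c > 0" for c :: real
    using that by (intro continuous_on_powr') (auto intro!: continuous_intros)
  have fact1: "((\<lambda>t. t powr (a + 1) *\<^sub>R wy t + ?q t) has_integral ?g Y - ?g 0) {0..Y}"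
  proof (rule fundamental_theorem_of_calculus_interior[OF Y])
    show "continuous_on {0..Y} ?g"
      using a by (intro continuous_intros cw cp) auto
    show "(?g has_vector_derivative t powr (a + 1) *\<^sub>R wy t + ?q t) (at t)" if "t \<in> {0<..<Y}" for t
    proof -
      have "(w has_vector_derivative wy t) (at t)"
        using der[of t] that at_within_Icc_at[of 0 t Y] by auto
      moreover have "((\<lambda>t. t powr (a + 1)) has_real_derivative (a + 1) * t powr a) (at t)"
        using that by (auto intro!: derivative_eq_intros)
      ultimately show ?thesis
        using that by (auto intro!: derivative_eq_intros)
    qed
  qed
  have qi: "?q integrable_on {0..Y}"
    using a by (intro integrable_continuous_real continuous_intros cw cp) auto
  have *: "((\<lambda>t. t powr (a + 1) *\<^sub>R wy t) has_integral - integral {0..Y} ?q) {0..Y}"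
    using has_integral_diff[OF fact1 integrable_integral[OF qi]] by simp
  then show "(\<lambda>t. t powr (a + 1) *\<^sub>R wy t) integrable_on {0..Y}" by blast
  have "((\<lambda>t. (\<eta> * (a + 1)) * t powr a) has_integral (\<eta> * (a + 1)) * (Y powr (a + 1) / (a + 1))) {0..Y}"
    using a Y by (intro has_integral_mult_right has_integral_powr_from_0) auto
  then have bi: "((\<lambda>t. (\<eta> * (a + 1)) * t powr a) has_integral \<eta> * Y powr (a + 1)) {0..Y}"
    using a by simp
  have "norm (integral {0..Y} ?q) \<le> integral {0..Y} (\<lambda>t. (\<eta> * (a + 1)) * t powr a)"
  proof (rule integral_norm_bound_integral[OF qi])
    fix t assume t: "t \<in> {0..Y}"
    have "norm (?q t) = (a + 1) * t powr a * norm (w Y - w t)"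
      using a by (simp add: norm_minus_commute)
    also have "\<dots> \<le> (a + 1) * t powr a * \<eta>"
      using a osc[OF t] by (intro mult_left_mono) auto
    finally show "norm (?q t) \<le> \<eta> * (a + 1) * t powr a" by (simp add: mult_ac)
  qed (use bi in blast)
  then show "norm (integral {0..Y} (\<lambda>t. t powr (a + 1) *\<^sub>R wy t)) \<le> \<eta> * Y powr (a + 1)"
    unfolding integral_unique[OF *] integral_unique[OF bi] by simp
qed

lemma has_vector_derivative_imp_continuous_on:
  assumes "\<And>t. t \<in> S \<Longrightarrow> (f has_vector_derivative f' t) (at t within S)"
  shows "continuous_on S f"
  using assms by (meson continuous_on_eq_continuous_within has_vector_derivative_continuous)

text \<open>Meant for \<open>w\<close> the difference quotient and \<open>h = u l\<close>: in the
  difference of two equations \<open>e\<close> cancels, and the parameter in the field leaves the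
  source \<open>hy = uy l\<close>. Integration in \<open>y\<close> turns the source into
  \<open>h x Y - h x 0\<close>, and the weighted term is controlled by oscillation alone.\<close>

lemma integrated_transport_derivative:
  fixes w wx wy h hy :: "real \<Rightarrow> real \<Rightarrow> 'v::euclidean_space"
  assumes a: "a > 0" and Y: "0 \<le> Y" and x: "x \<in> {0..\<rho>}"
    and wx: "\<And>x y. \<lbrakk>x \<in> {0..\<rho>}; y \<in> {0..Y}\<rbrakk> \<Longrightarrow>
       ((\<lambda>x. w x y) has_vector_derivative wx x y) (at x within {0..\<rho>})"
    and wy: "\<And>x y. \<lbrakk>x \<in> {0..\<rho>}; y \<in> {0..Y}\<rbrakk> \<Longrightarrow>
       (w x has_vector_derivative wy x y) (at y within {0..Y})"
    and hy: "\<And>x y. \<lbrakk>x \<in> {0..\<rho>}; y \<in> {0..Y}\<rbrakk> \<Longrightarrow>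
       (h x has_vector_derivative hy x y) (at y within {0..Y})"
    and cont: "continuous_on ({0..\<rho>} \<times> {0..Y}) (\<lambda>(x, y). wx x y)"
    and transport: "\<And>x y. \<lbrakk>x \<in> {0..\<rho>}; y \<in> {0..Y}\<rbrakk> \<Longrightarrow>
       wx x y = - (y powr (a + 1) *\<^sub>R wy x y) - hy x y"
    and osc: "\<And>y. y \<in> {0..Y} \<Longrightarrow> norm (w x Y - w x y) \<le> \<eta>"
  shows "((\<lambda>x. integral {0..Y} (w x)) has_vector_derivative integral {0..Y} (wx x)) (at x within {0..\<rho>})"
    and "norm (integral {0..Y} (wx x) + (h x Y - h x 0)) \<le> \<eta> * Y powr (a + 1)"
proof -
  have "w x integrable_on {0..Y}" if "x \<in> {0..\<rho>}" for x
    by (intro integrable_continuous_real has_vector_derivative_imp_continuous_on[of _ _ "wy x"] wy that)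
  then show "((\<lambda>x. integral {0..Y} (w x)) has_vector_derivative integral {0..Y} (wx x)) (at x within {0..\<rho>})"
    using wx cont x unfolding box_real(2)[symmetric]
    by (intro leibniz_rule_vector_derivative[where fx = wx]) auto
  note bd = weighted_integral_bound[OF a Y wy[OF x] osc]
  have "(hy x has_integral h x Y - h x 0) {0..Y}"
    using hy[OF x] Y by (intro fundamental_theorem_of_calculus) auto
  then have "((\<lambda>y. - (y powr (a + 1) *\<^sub>R wy x y) - hy x y) has_integral
      - integral {0..Y} (\<lambda>y. y powr (a + 1) *\<^sub>R wy x y) - (h x Y - h x 0)) {0..Y}"
    using bd(1) by (intro has_integral_diff has_integral_neg integrable_integral)
  then have "(wx x has_integral
      - integral {0..Y} (\<lambda>y. y powr (a + 1) *\<^sub>R wy x y) - (h x Y - h x 0)) {0..Y}"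
    by (rule has_integral_eq[rotated]) (use transport x in auto)
  then have "integral {0..Y} (wx x) + (h x Y - h x 0) = - integral {0..Y} (\<lambda>y. y powr (a + 1) *\<^sub>R wy x y)"
    by (simp add: integral_unique)
  then show "norm (integral {0..Y} (wx x) + (h x Y - h x 0)) \<le> \<eta> * Y powr (a + 1)"
    using bd(2) by simp
qed

text \<open>The normal derivative \<open>uy x 0\<close> is constant along the characteristic \<open>y = 0\<close>, so its value at the
  origin serves for all \<open>x\<close>.\<close>

lemma transport_solution_expansion:
  fixes u ux uy :: "real \<Rightarrow> real \<Rightarrow> 'v::euclidean_space"
  assumes a: "a > 0" and \<rho>: "\<rho> > 0"
    and ux: "\<And>x y. \<lbrakk>x \<in> {0..\<rho>}; y \<in> {0..\<rho>}\<rbrakk> \<Longrightarrow>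
       ((\<lambda>x. u x y) has_vector_derivative ux x y) (at x within {0..\<rho>})"
    and uy: "\<And>x y. \<lbrakk>x \<in> {0..\<rho>}; y \<in> {0..\<rho>}\<rbrakk> \<Longrightarrow>
       (u x has_vector_derivative uy x y) (at y within {0..\<rho>})"
    and cont: "continuous_on ({0..\<rho>} \<times> {0..\<rho>}) (\<lambda>(x, y). uy x y)"
    and transport: "\<And>x y. \<lbrakk>x \<in> {0..\<rho>}; y \<in> {0..\<rho>}\<rbrakk> \<Longrightarrow> ux x y = e - y powr (a + 1) *\<^sub>R uy x y"
    and \<epsilon>: "\<epsilon> > 0"
  shows "\<exists>\<delta>\<in>{0<..\<rho>}. \<forall>y\<in>{0<..\<delta>}. \<forall>x\<in>{0..\<rho>}.
     norm (u x y - u x 0 - (u 0 y - u 0 0) + (x * y powr (a + 1)) *\<^sub>R uy 0 0) \<le> \<epsilon> * y powr (a + 1)"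
proof -
  \<comment> \<open>Mean value inequality in \<open>x\<close>, after removing the part of
    \<open>u\<close> predicted by a constant normal derivative \<open>A\<close>. It serves three
    times: at \<open>y = 0\<close>, with \<open>A = 0\<close> and a global bound \<open>M\<close>,
    and finally with \<open>A = uy 0 0\<close>.\<close>
  have growth: "norm (u x y - u 0 y - x *\<^sub>R e + (x * y powr (a + 1)) *\<^sub>R A) \<le> x * (y powr (a + 1) * K)"
    if x: "x \<in> {0..\<rho>}" and y: "y \<in> {0..\<rho>}" and K: "\<And>r. r \<in> {0..\<rho>} \<Longrightarrow> norm (uy r y - A) \<le> K" for x y A K
  proof (cases "x = 0")
    case False
    let ?f = "\<lambda>r. u r y - r *\<^sub>R e + (r * y powr (a + 1)) *\<^sub>R A"
    let ?f' = "\<lambda>r. - (y powr (a + 1) *\<^sub>R (uy r y - A))"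
    have der: "(?f has_vector_derivative ?f' r) (at r within {0..\<rho>})" if "r \<in> {0..\<rho>}" for r
      using ux[OF that y] transport[OF that y]
      by (auto intro!: derivative_eq_intros simp: scaleR_diff_right)
    have "norm (?f x - ?f 0) \<le> (y powr (a + 1) * K) * x - (y powr (a + 1) * K) * 0"
    proof (rule differentiable_bound_general[where f' = ?f' and \<phi>' = "\<lambda>_. y powr (a + 1) * K"])
      show "continuous_on {0..x} ?f"
        using x by (intro continuous_on_subset[OF has_vector_derivative_imp_continuous_on[OF der]]) auto
      show "(?f has_vector_derivative ?f' r) (at r)" if "0 < r" "r < x" for r
        using der[of r] that x at_within_Icc_at[of 0 r \<rho>] by auto
      show "norm (?f' r) \<le> y powr (a + 1) * K" if "0 < r" "r < x" for r
        using K[of r] that x by (auto intro!: mult_left_mono)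
      show "((*) (y powr (a + 1) * K) has_vector_derivative y powr (a + 1) * K) (at r)" for r
        by (auto intro!: derivative_eq_intros simp flip: has_real_derivative_iff_has_vector_derivative)
    qed (use x False in \<open>auto intro!: continuous_intros\<close>)
    then show ?thesis by (simp add: algebra_simps)
  qed auto
  have comp: "compact ({0..\<rho>} \<times> {0..\<rho>})" by (intro compact_Times) auto
  obtain M where M: "\<And>x y. \<lbrakk>x \<in> {0..\<rho>}; y \<in> {0..\<rho>}\<rbrakk> \<Longrightarrow> norm (uy x y) \<le> M"
    using compact_imp_bounded[OF compact_continuous_image[OF cont comp]]
    unfolding bounded_iff by (metis (no_types, lifting) SigmaI case_prod_conv imageI)
  have base: "u x 0 = u 0 0 + x *\<^sub>R e" if "x \<in> {0..\<rho>}" for x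
    using growth[of x 0 0 M] that M \<rho> by (simp add: algebra_simps)
  \<comment> \<open>No second derivatives are available, so the equation cannot be differentiated in
    \<open>y\<close>. Instead, the difference quotients in \<open>y\<close> at \<open>x\<close> and
    at 0 differ by O(y^a), by \<open>growth\<close> and \<open>base\<close>, and hence have the same
    limit.\<close>
  have const: "uy x 0 = uy 0 0" if x: "x \<in> {0..\<rho>}" for x
  proof -
    have q: "((\<lambda>y. (u x y - u x 0) /\<^sub>R y) \<longlongrightarrow> uy x 0) (at_right 0)" if "x \<in> {0..\<rho>}" for x
    proof -
      have "((\<lambda>y. (1 / \<bar>y\<bar>) *\<^sub>R (u x y - (u x 0 + y *\<^sub>R uy x 0))) \<longlongrightarrow> 0) (at_right 0)"
        using uy[OF that, of 0] \<rho> that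
        by (simp add: has_vector_derivative_def has_derivative_within at_within_Icc_at_right)
      from tendsto_add[OF this tendsto_const[of "uy x 0"]]
      have "((\<lambda>y. (1 / \<bar>y\<bar>) *\<^sub>R (u x y - (u x 0 + y *\<^sub>R uy x 0)) + uy x 0) \<longlongrightarrow> uy x 0) (at_right 0)"
        by simp
      then show ?thesis
        by (rule Lim_transform_eventually)
          (auto simp: eventually_at_filter scaleR_diff_right scaleR_add_right divide_inverse)
    qed
    have "((\<lambda>y. (u x y - u x 0) /\<^sub>R y - (u 0 y - u 0 0) /\<^sub>R y) \<longlongrightarrow> uy x 0 - uy 0 0) (at_right 0)"
      using x \<rho> by (intro tendsto_diff q) auto
    moreover have "((\<lambda>y. (u x y - u x 0) /\<^sub>R y - (u 0 y - u 0 0) /\<^sub>R y) \<longlongrightarrow> 0) (at_right 0)"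
    proof (rule Lim_null_comparison)
      \<comment> \<open>The exponent is written \<open>a - 0\<close> to match the form
        \<open>q - p\<close> of the limit lemma for powers.\<close>
      show "\<forall>\<^sub>F y in at_right 0. norm ((u x y - u x 0) /\<^sub>R y - (u 0 y - u 0 0) /\<^sub>R y) \<le> x * M * y powr (a - 0)"
        unfolding eventually_at_right_field
      proof (intro exI[of _ \<rho>] conjI allI impI \<rho>)
        fix y :: real assume y: "0 < y" "y < \<rho>"
        have "(u x y - u x 0) /\<^sub>R y - (u 0 y - u 0 0) /\<^sub>R y = (u x y - u 0 y - x *\<^sub>R e) /\<^sub>R y"
          using base[OF x] by (simp add: algebra_simps)
        also have "norm \<dots> = norm (u x y - u 0 y - x *\<^sub>R e) / y"
          using y by (simp only: norm_scaleR) (simp add: divide_inverse mult.commute)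
        also have "\<dots> \<le> x * (y powr (a + 1) * M) / y"
          using growth[of x y 0 M] M x y by (intro divide_right_mono) auto
        also have "\<dots> = x * M * y powr (a - 0)"
          using y by (simp add: powr_add)
        finally show "norm ((u x y - u x 0) /\<^sub>R y - (u 0 y - u 0 0) /\<^sub>R y) \<le> x * M * y powr (a - 0)" .
      qed
      show "((\<lambda>y. x * M * y powr (a - 0)) \<longlongrightarrow> 0) (at_right 0)"
        using powr_diff_tendsto_0_at_right[OF a] tendsto_mult_right_zero by fastforce
    qed
    ultimately have "uy x 0 - uy 0 0 = 0"
      by (rule tendsto_unique[OF trivial_limit_at_right_real])
    then show ?thesis by simp
  qed
  obtain \<delta> where \<delta>: "\<delta> > 0"
    "\<And>p q. \<lbrakk>p \<in> {0..\<rho>} \<times> {0..\<rho>}; q \<in> {0..\<rho>} \<times> {0..\<rho>}; dist q p < \<delta>\<rbrakk> \<Longrightarrow>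
       dist (case q of (x, y) \<Rightarrow> uy x y) (case p of (x, y) \<Rightarrow> uy x y) < \<epsilon> / \<rho>"
    using compact_uniformly_continuous[OF cont comp] \<epsilon> \<rho> unfolding uniformly_continuous_on_def
    by (metis divide_pos_pos)
  show ?thesis
  proof (intro bexI[of _ "min \<rho> (\<delta> / 2)"] ballI)
    fix x y assume y: "y \<in> {0<..min \<rho> (\<delta> / 2)}" and x: "x \<in> {0..\<rho>}"
    have *: "norm (uy r y - uy 0 0) \<le> \<epsilon> / \<rho>" if "r \<in> {0..\<rho>}" for r
      using \<delta>(2)[of "(r, 0)" "(r, y)"] that y const[OF that] \<open>\<delta> > 0\<close>
      by (auto simp: dist_Pair_Pair dist_norm)
    have "norm (u x y - u 0 y - x *\<^sub>R e + (x * y powr (a + 1)) *\<^sub>R uy 0 0) \<le> x * (y powr (a + 1) * (\<epsilon> / \<rho>))"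
      using growth[OF x _ *] y by auto
    also have "\<dots> \<le> \<rho> * (y powr (a + 1) * (\<epsilon> / \<rho>))"
      using x \<epsilon> \<rho> by (intro mult_right_mono) auto
    also have "\<dots> = \<epsilon> * y powr (a + 1)" using \<rho> by simp
    finally show "norm (u x y - u x 0 - (u 0 y - u 0 0) + (x * y powr (a + 1)) *\<^sub>R uy 0 0) \<le> \<epsilon> * y powr (a + 1)"
      using base[OF x] by (simp add: algebra_simps)
  qed (use \<rho> \<open>\<delta> > 0\<close> in auto)
qed

section \<open>The second difference of the parameter derivative\<close>

text \<open>With \<open>g = u 0 0 Y - u 0 0 0\<close>, the integrated equation and the expansion of
  \<open>u 0\<close> say that the integral of the quotient over \<open>{0..Y}\<close> has
  \<open>x\<close>-derivative \<open>- g + (x * Y powr (a + 1)) *\<^sub>R uy 0 0 0\<close> up to a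
  small multiple of \<open>Y powr (a + 1)\<close>. The second difference over the nodes 0,
  \<open>\<rho> / 2\<close>, \<open>\<rho>\<close> removes everything affine in \<open>x\<close>,
  including \<open>g\<close>.\<close>

lemma limit_second_difference:
  fixes u ux uy :: "real \<Rightarrow> real \<Rightarrow> real \<Rightarrow> 'v::euclidean_space" and v :: "real \<Rightarrow> real \<Rightarrow> 'v"
  assumes a: "a > 0" and \<rho>: "\<rho> > 0"
    and ux: "\<And>l x y. \<lbrakk>l \<in> {0..1}; x \<in> {0..\<rho>}; y \<in> {0..\<rho>}\<rbrakk> \<Longrightarrow>
       ((\<lambda>x. u l x y) has_vector_derivative ux l x y) (at x within {0..\<rho>})"
    and uy: "\<And>l x y. \<lbrakk>l \<in> {0..1}; x \<in> {0..\<rho>}; y \<in> {0..\<rho>}\<rbrakk> \<Longrightarrow>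
       (u l x has_vector_derivative uy l x y) (at y within {0..\<rho>})"
    and cont: "\<And>l. l \<in> {0..1} \<Longrightarrow> continuous_on ({0..\<rho>} \<times> {0..\<rho>}) (\<lambda>(x, y). uy l x y)"
    and transport: "\<And>l x y. \<lbrakk>l \<in> {0..1}; x \<in> {0..\<rho>}; y \<in> {0..\<rho>}\<rbrakk> \<Longrightarrow>
       ux l x y = e - (y powr (a + 1) + l) *\<^sub>R uy l x y"
    and contv: "continuous_on ({0..\<rho>} \<times> {0..\<rho>}) (\<lambda>(x, y). v x y)"
    and quot: "\<And>\<epsilon>. \<epsilon> > 0 \<Longrightarrow> \<forall>\<^sub>F l in at_right 0. \<forall>x\<in>{0..\<rho>}. \<forall>y\<in>{0..\<rho>}.
       norm ((u l x y - u 0 x y) /\<^sub>R l - v x y) \<le> \<epsilon>"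
    and \<epsilon>: "\<epsilon> > 0"
  shows "\<exists>\<delta>\<in>{0<..\<rho>}. \<forall>y\<in>{0<..\<delta>}.
     norm (integral {0..y} (v \<rho>) - 2 *\<^sub>R integral {0..y} (v (\<rho> / 2)) + integral {0..y} (v 0)
       - ((\<rho> / 2)\<^sup>2 * y powr (a + 1)) *\<^sub>R uy 0 0 0) \<le> \<epsilon> * y powr (a + 1)"
proof -
  \<comment> \<open>In the proof below, the derivative of \<open>\<psi>\<close> costs \<open>6 * \<eta>\<close> and the replacement of \<open>w\<close> by \<open>v\<close> costs
    \<open>4 * \<eta>\<close>.  A single parameter \<open>l\<close>, chosen after \<open>Y\<close>, suffices.\<close>
  define \<eta> where "\<eta> = \<epsilon> / (10 * \<rho>)"
  have \<eta>: "\<eta> > 0" using \<epsilon> \<rho> by (simp add: \<eta>_def)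
  have comp: "compact ({0..\<rho>} \<times> {0..\<rho>})" by (intro compact_Times) auto
  obtain M where M: "\<And>x y. \<lbrakk>x \<in> {0..\<rho>}; y \<in> {0..\<rho>}\<rbrakk> \<Longrightarrow> norm (v x y) \<le> M"
    using compact_imp_bounded[OF compact_continuous_image[OF contv comp]]
    unfolding bounded_iff by (metis (no_types, lifting) SigmaI case_prod_conv imageI)
  have M0: "M \<ge> 0" using order_trans[OF norm_ge_zero M[of 0 0]] \<rho> by auto
  have "\<exists>\<delta>\<in>{0<..\<rho>}. \<forall>y\<in>{0<..\<delta>}. \<forall>x\<in>{0..\<rho>}.
     norm (u 0 x y - u 0 x 0 - (u 0 0 y - u 0 0 0) + (x * y powr (a + 1)) *\<^sub>R uy 0 0 0) \<le> \<eta> * y powr (a + 1)"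
    by (rule transport_solution_expansion[OF a \<rho> ux uy cont _ \<eta>]) (use transport[of 0] in auto)
  then obtain \<delta>1 where \<delta>1: "\<delta>1 \<in> {0<..\<rho>}" "\<And>x y. \<lbrakk>y \<in> {0<..\<delta>1}; x \<in> {0..\<rho>}\<rbrakk> \<Longrightarrow>
     norm (u 0 x y - u 0 x 0 - (u 0 0 y - u 0 0 0) + (x * y powr (a + 1)) *\<^sub>R uy 0 0 0) \<le> \<eta> * y powr (a + 1)"
    by blast
  obtain \<delta>2 where \<delta>2: "\<delta>2 > 0"
    "\<And>p q. \<lbrakk>p \<in> {0..\<rho>} \<times> {0..\<rho>}; q \<in> {0..\<rho>} \<times> {0..\<rho>}; dist q p < \<delta>2\<rbrakk> \<Longrightarrow>
       dist (case q of (x, y) \<Rightarrow> v x y) (case p of (x, y) \<Rightarrow> v x y) < \<eta>"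
    using compact_uniformly_continuous[OF contv comp] \<eta> unfolding uniformly_continuous_on_def
    by metis
  have tri4: "norm (p - q + r - s) \<le> norm p + norm q + norm r + norm s" for p q r s :: 'v
    by norm
  have tri5: "norm (p - q - r + 2 *\<^sub>R s - t) \<le> norm p + norm q + norm r + 2 * norm s + norm t" for p q r s t :: 'v
    by norm
  show ?thesis
  \<comment> \<open>The bound 1 on \<open>Y\<close> gives \<open>K \<le> 1\<close>, so errors
    \<open>\<eta> * K\<close> are also errors \<open>\<eta>\<close>. Halving
    \<open>\<delta>2\<close> makes distances inside \<open>{0..Y}\<close> strictly smaller than
    \<open>\<delta>2\<close>.\<close>
  proof (intro bexI[of _ "min (min \<delta>1 1) (\<delta>2 / 2)"] ballI)
    fix Y assume Y: "Y \<in> {0<..min (min \<delta>1 1) (\<delta>2 / 2)}"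
    have Y\<rho>: "0 < Y" "Y \<le> 1" "Y \<le> \<rho>" using Y \<delta>1(1) by auto
    define K where "K = Y powr (a + 1)"
    have K: "0 < K" "K \<le> 1" using Y\<rho> a by (auto simp: K_def intro!: powr_le1)
    have sub: "{0..Y} \<subseteq> {0..\<rho>}" using Y\<rho> by auto
    \<comment> \<open>Since \<open>M + \<eta> + 1\<close> bounds the quotient, such an
      \<open>l\<close> makes \<open>u l - u 0\<close>, which is \<open>l\<close> times the quotient,
      at most \<open>\<eta> * K\<close>. Errors must be small relative to \<open>K\<close>, not
      merely small.\<close>
    have "\<forall>\<^sub>F l in at_right 0. l \<in> {0<..<min 1 (\<eta> * K / (M + \<eta> + 1))}"
      using \<eta> K M0 by (intro eventually_at_right_real) auto
    moreover have "\<forall>\<^sub>F l in at_right 0. \<forall>x\<in>{0..\<rho>}. \<forall>y\<in>{0..\<rho>}.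
       norm ((u l x y - u 0 x y) /\<^sub>R l - v x y) \<le> \<eta> * K"
      using \<eta> K by (intro quot) auto
    ultimately obtain l where l: "l \<in> {0<..<min 1 (\<eta> * K / (M + \<eta> + 1))}"
      and q: "\<And>x y. \<lbrakk>x \<in> {0..\<rho>}; y \<in> {0..\<rho>}\<rbrakk> \<Longrightarrow> norm ((u l x y - u 0 x y) /\<^sub>R l - v x y) \<le> \<eta> * K"
      using eventually_happens'[OF trivial_limit_at_right_real eventually_conj] by blast
    have l01: "l \<in> {0..1}" "l > 0" using l by auto
    define w where "w = (\<lambda>x y. (u l x y - u 0 x y) /\<^sub>R l)"
    define wx where "wx = (\<lambda>x y. (ux l x y - ux 0 x y) /\<^sub>R l)"
    define wy where "wy = (\<lambda>x y. (uy l x y - uy 0 x y) /\<^sub>R l)"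
    have \<eta>K: "\<eta> * K \<le> \<eta>" using \<eta> K by simp
    have wv: "norm (w x y - v x y) \<le> \<eta> * K" if "x \<in> {0..\<rho>}" "y \<in> {0..\<rho>}" for x y
      using q[OF that] by (simp add: w_def)
    have close: "norm (u l x y - u 0 x y) \<le> \<eta> * K" if "x \<in> {0..\<rho>}" "y \<in> {0..\<rho>}" for x y
    proof -
      have "norm (w x y) \<le> M + \<eta> + 1"
        using wv[OF that] M[OF that] \<eta>K norm_triangle_sub[of "w x y" "v x y"] by linarith
      then have "l * norm (w x y) \<le> l * (M + \<eta> + 1)"
        using l01 by (intro mult_left_mono) auto
      moreover have "norm (u l x y - u 0 x y) = l * norm (w x y)"
        using l01 unfolding w_def norm_scaleR by simp
      ultimately have "norm (u l x y - u 0 x y) \<le> l * (M + \<eta> + 1)" by simp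
      also have "\<dots> \<le> \<eta> * K" using l M0 \<eta> by (simp add: field_simps)
      finally show ?thesis .
    qed
    \<comment> \<open>Uniform closeness of \<open>w\<close> to \<open>v\<close> replaces any bound
      on \<open>wy\<close>: one \<open>\<eta>\<close> for the uniform continuity of \<open>v\<close>
      and one for each of the two passages between \<open>w\<close> and \<open>v\<close>.\<close>
    have osc: "norm (w x Y - w x y) \<le> 3 * \<eta>" if "x \<in> {0..\<rho>}" "y \<in> {0..Y}" for x y
    proof -
      have "norm (v x Y - v x y) < \<eta>"
        using \<delta>2(2)[of "(x, y)" "(x, Y)"] that Y \<delta>1(1) by (auto simp: dist_Pair_Pair dist_norm)
      moreover have "norm (w x Y - v x Y) \<le> \<eta>" "norm (w x y - v x y) \<le> \<eta>"
        using wv[of x Y] wv[of x y] that Y\<rho> \<eta>K by auto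
      ultimately show ?thesis by norm
    qed
    have wxd: "((\<lambda>x. w x y) has_vector_derivative wx x y) (at x within {0..\<rho>})"
      and wyd: "(w x has_vector_derivative wy x y) (at y within {0..\<rho>})"
      if "x \<in> {0..\<rho>}" "y \<in> {0..\<rho>}" for x y
      unfolding w_def wx_def wy_def using l01 that
      by (auto intro!: derivative_eq_intros ux uy simp: scaleR_conv_of_real)
    have contu: "continuous_on ({0..\<rho>} \<times> {0..\<rho>}) (\<lambda>p. uy s (fst p) (snd p))" if "s \<in> {0..1}" for s
      using cont[OF that] by (simp add: case_prod_unfold)
    \<comment> \<open>Only \<open>uy\<close> is assumed continuous; the equation transfers this to
      \<open>ux\<close> and hence to \<open>wx\<close>.\<close>
    have wxc: "continuous_on ({0..\<rho>} \<times> {0..\<rho>}) (\<lambda>(x, y). wx x y)"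
    proof (rule continuous_on_eq)
      show "continuous_on ({0..\<rho>} \<times> {0..\<rho>}) (\<lambda>p. ((e - (snd p powr (a + 1) + l) *\<^sub>R uy l (fst p) (snd p))
         - (e - (snd p powr (a + 1) + 0) *\<^sub>R uy 0 (fst p) (snd p))) /\<^sub>R l)"
        using l01 a by (intro continuous_intros contu continuous_on_powr') auto
    qed (use transport l01 in \<open>auto simp: wx_def\<close>)
    have trans: "wx x y = - (y powr (a + 1) *\<^sub>R wy x y) - uy l x y" if "x \<in> {0..\<rho>}" "y \<in> {0..\<rho>}" for x y
      using l01 that by (simp add: wx_def wy_def transport algebra_simps)
    define g where "g = u 0 0 Y - u 0 0 0"
    define A where "A = uy 0 0 0"
    \<comment> \<open>This is the integral of the quotient minus its predicted non-constant part, so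
      its derivative should be small relative to \<open>K\<close>.\<close>
    define \<psi> where "\<psi> = (\<lambda>x. integral {0..Y} (w x) + x *\<^sub>R g - (x\<^sup>2 / 2 * K) *\<^sub>R A)"
    define \<psi>' where "\<psi>' = (\<lambda>x. integral {0..Y} (wx x) + g - (x * K) *\<^sub>R A)"
    have \<psi>d: "(\<psi> has_vector_derivative \<psi>' x) (at x within {0..\<rho>})"
      and \<psi>b: "norm (\<psi>' x) \<le> 6 * \<eta> * K" if x: "x \<in> {0..\<rho>}" for x
    proof -
      note itd = integrated_transport_derivative[where w = w and wx = wx and wy = wy
          and h = "u l" and hy = "uy l" and \<rho> = \<rho> and Y = Y and x = x and \<eta> = "3 * \<eta>", OF a _ x]
      have 1: "((\<lambda>x. integral {0..Y} (w x)) has_vector_derivative integral {0..Y} (wx x)) (at x within {0..\<rho>})"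
       and 2: "norm (integral {0..Y} (wx x) + (u l x Y - u l x 0)) \<le> 3 * \<eta> * K"
        using itd Y\<rho> wxd trans osc[OF x] wyd[THEN has_vector_derivative_within_subset[OF _ sub]]
          uy[OF l01(1), THEN has_vector_derivative_within_subset[OF _ sub]]
          continuous_on_subset[OF wxc, of "{0..\<rho>} \<times> {0..Y}"] sub
        unfolding K_def by (auto simp: subset_iff)
      show "(\<psi> has_vector_derivative \<psi>' x) (at x within {0..\<rho>})"
        unfolding \<psi>_def \<psi>'_def
        by (auto intro!: derivative_eq_intros 1)
      \<comment> \<open>Three of the six units come from the integrated equation; the other three
        come from replacing \<open>u l\<close> by \<open>u 0\<close> at \<open>Y\<close> and at 0
        and from the expansion of \<open>u 0\<close>.\<close>
      have "norm (u l x Y - u 0 x Y) \<le> \<eta> * K" "norm (u l x 0 - u 0 x 0) \<le> \<eta> * K"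
        using close x Y\<rho> \<rho> by auto
      moreover have "norm (u 0 x Y - u 0 x 0 - g + (x * K) *\<^sub>R A) \<le> \<eta> * K"
        using \<delta>1(2)[of Y x] Y x by (auto simp: g_def A_def K_def)
      moreover have eq: "\<psi>' x = (integral {0..Y} (wx x) + (u l x Y - u l x 0)) - (u l x Y - u 0 x Y)
         + (u l x 0 - u 0 x 0) - (u 0 x Y - u 0 x 0 - g + (x * K) *\<^sub>R A)"
        by (simp add: \<psi>'_def algebra_simps)
      ultimately show "norm (\<psi>' x) \<le> 6 * \<eta> * K"
        using 2 tri4[of "integral {0..Y} (wx x) + (u l x Y - u l x 0)" "u l x Y - u 0 x Y"
            "u l x 0 - u 0 x 0" "u 0 x Y - u 0 x 0 - g + (x * K) *\<^sub>R A"]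
        unfolding eq by (simp add: mult.assoc)
    qed
    have mvt: "norm (\<psi> q - \<psi> p) \<le> 6 * \<eta> * K * (q - p)" if "0 \<le> p" "p \<le> q" "q \<le> \<rho>" for p q
    proof -
      have "norm (\<psi> q - \<psi> p) \<le> (6 * \<eta> * K) * norm (q - p)"
      proof (rule differentiable_bound[of "{0..\<rho>}" \<psi> "\<lambda>x h. h *\<^sub>R \<psi>' x"])
        show "onorm (\<lambda>h. h *\<^sub>R \<psi>' x) \<le> 6 * \<eta> * K" if "x \<in> {0..\<rho>}" for x
          using \<psi>b[OF that] by (intro onorm_le) (simp add: mult.commute mult_left_mono)
      qed (use \<psi>d that in \<open>auto simp: has_vector_derivative_def\<close>)
      then show ?thesis using that by simp
    qed
    have int: "norm (integral {0..Y} (w x) - integral {0..Y} (v x)) \<le> \<eta> * K * \<rho>" if x: "x \<in> {0..\<rho>}" for x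
    proof -
      have wi: "w x integrable_on {0..Y}"
        by (intro integrable_continuous_real has_vector_derivative_imp_continuous_on[of _ _ "wy x"]
          has_vector_derivative_within_subset[OF wyd sub] x) (use sub in auto)
      have "continuous_on {0..Y} (\<lambda>y. case (x, y) of (x, y) \<Rightarrow> v x y)"
        by (rule continuous_on_compose2[OF contv]) (use sub x in \<open>auto intro!: continuous_intros\<close>)
      then have vi: "v x integrable_on {0..Y}"
        by (simp add: integrable_continuous_real)
      have "norm (integral {0..Y} (\<lambda>y. w x y - v x y)) \<le> integral {0..Y} (\<lambda>y. \<eta> * K)"
        using wv[OF x] sub by (intro integral_norm_bound_integral integrable_diff wi vi) auto
      also have "\<dots> \<le> \<eta> * K * \<rho>"
        using Y\<rho> \<eta> K by simp
      finally show ?thesis using wi vi by (simp add: integral_diff)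
    qed
    have e1: "norm (\<psi> \<rho> - \<psi> (\<rho> / 2)) \<le> 3 * (\<eta> * K * \<rho>)" "norm (\<psi> (\<rho> / 2) - \<psi> 0) \<le> 3 * (\<eta> * K * \<rho>)"
      using mvt[of "\<rho> / 2" \<rho>] mvt[of 0 "\<rho> / 2"] \<rho> by (auto simp: algebra_simps)
    have e2: "norm (integral {0..Y} (w \<rho>) - integral {0..Y} (v \<rho>)) \<le> \<eta> * K * \<rho>"
       "norm (integral {0..Y} (w (\<rho>/2)) - integral {0..Y} (v (\<rho>/2))) \<le> \<eta> * K * \<rho>"
       "norm (integral {0..Y} (w 0) - integral {0..Y} (v 0)) \<le> \<eta> * K * \<rho>"
      using int \<rho> by auto
    \<comment> \<open>In the second difference the terms in \<open>g\<close> cancel, and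
      \<open>x\<^sup>2 / 2\<close> with step \<open>\<rho> / 2\<close> yields exactly the
      coefficient \<open>(\<rho> / 2)\<^sup>2\<close>.\<close>
    have eq5: "integral {0..Y} (v \<rho>) - 2 *\<^sub>R integral {0..Y} (v (\<rho> / 2)) + integral {0..Y} (v 0)
       - ((\<rho> / 2)\<^sup>2 * K) *\<^sub>R A
      = (\<psi> \<rho> - \<psi> (\<rho> / 2)) - (\<psi> (\<rho> / 2) - \<psi> 0)
        - (integral {0..Y} (w \<rho>) - integral {0..Y} (v \<rho>))
        + 2 *\<^sub>R (integral {0..Y} (w (\<rho>/2)) - integral {0..Y} (v (\<rho>/2)))
        - (integral {0..Y} (w 0) - integral {0..Y} (v 0))"
    proof -
      define Z where "Z = ((\<rho> / 2)\<^sup>2 * K) *\<^sub>R A"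
      define G where "G = (\<rho> / 2) *\<^sub>R g"
      have "(\<rho>\<^sup>2 / 2 * K) *\<^sub>R A = Z + Z" "((\<rho> / 2)\<^sup>2 / 2 * K) *\<^sub>R A = (1 / 2) *\<^sub>R Z"
        "\<rho> *\<^sub>R g = G + G"
        unfolding Z_def G_def by (simp_all add: power2_eq_square field_simps flip: scaleR_add_left)
      then show ?thesis
        unfolding Z_def[symmetric] \<psi>_def G_def[symmetric]
        by (simp add: scaleR_2 algebra_simps flip: scaleR_add_left)
    qed
    have "norm (integral {0..Y} (v \<rho>) - 2 *\<^sub>R integral {0..Y} (v (\<rho> / 2)) + integral {0..Y} (v 0)
       - ((\<rho> / 2)\<^sup>2 * K) *\<^sub>R A) \<le> 10 * (\<eta> * K * \<rho>)"
      unfolding eq5 using e1 e2 tri5[of "\<psi> \<rho> - \<psi> (\<rho> / 2)" "\<psi> (\<rho> / 2) - \<psi> 0"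
          "integral {0..Y} (w \<rho>) - integral {0..Y} (v \<rho>)"
          "integral {0..Y} (w (\<rho>/2)) - integral {0..Y} (v (\<rho>/2))"
          "integral {0..Y} (w 0) - integral {0..Y} (v 0)"]
      by linarith
    also have "\<dots> = \<epsilon> * K" using \<rho> by (simp add: \<eta>_def)
    finally show "norm (integral {0..Y} (v \<rho>) - 2 *\<^sub>R integral {0..Y} (v (\<rho> / 2)) + integral {0..Y} (v 0)
       - ((\<rho> / 2)\<^sup>2 * Y powr (a + 1)) *\<^sub>R uy 0 0 0) \<le> \<epsilon> * Y powr (a + 1)"
      by (simp add: K_def A_def)
  qed (use \<delta>1 \<delta>2 in auto)
qed

lemma norm_divideR: "c > 0 \<Longrightarrow> norm (x /\<^sub>R c) = norm x / c"
  by (simp add: divide_inverse_commute)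

text \<open>Integration raises both the degree and the order of the remainder by one, which turns
  the threshold \<open>a\<close> for \<open>v\<close> into the threshold \<open>a + 1\<close> for
  its integral. The integral of the remainder is bounded crudely by its largest bound times the
  length \<open>y\<close>.\<close>

lemma integral_polynomial_expansion:
  fixes f :: "real \<Rightarrow> 'v::euclidean_space"
  assumes f: "continuous_on {0..\<rho>} f" and \<theta>: "\<theta> > 0" and C: "C \<ge> 0"
    and exp: "\<And>t. t \<in> {0..\<rho>} \<Longrightarrow> norm (f t - (\<Sum>i\<le>k. t ^ i *\<^sub>R d i)) \<le> C * t powr \<theta>"
    and y: "y \<in> {0<..\<rho>}"
  shows "norm (integral {0..y} f - (\<Sum>i\<le>Suc k. y ^ i *\<^sub>R (if i = 0 then 0 else d (i - 1) /\<^sub>R real i)))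
           \<le> C * y powr (\<theta> + 1)"
proof -
  let ?P = "\<lambda>t. \<Sum>i\<le>k. t ^ i *\<^sub>R d i"
  let ?Q = "\<lambda>t. \<Sum>i\<le>k. (t ^ Suc i / real (Suc i)) *\<^sub>R d i"
  have "(?Q has_vector_derivative ?P t) (at t within {0..y})" for t
  proof (rule has_vector_derivative_sum)
    fix i
    have "((\<lambda>t. t ^ Suc i / real (Suc i)) has_real_derivative t ^ i) (at t within {0..y})"
      by (rule derivative_eq_intros refl | simp del: of_nat_Suc)+
    then show "((\<lambda>t. (t ^ Suc i / real (Suc i)) *\<^sub>R d i) has_vector_derivative t ^ i *\<^sub>R d i) (at t within {0..y})"
      using has_vector_derivative_scaleR[OF _ has_vector_derivative_const[of "d i"]] by fastforce
  qed
  then have "(?P has_integral ?Q y - ?Q 0) {0..y}"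
    using y by (intro fundamental_theorem_of_calculus) auto
  then have P: "(?P has_integral ?Q y) {0..y}" by simp
  have f': "f integrable_on {0..y}"
    using y by (intro integrable_continuous_real continuous_on_subset[OF f]) auto
  have "norm (integral {0..y} (\<lambda>t. f t - ?P t)) \<le> integral {0..y} (\<lambda>t. C * y powr \<theta>)"
  proof (intro integral_norm_bound_integral integrable_diff f')
    fix t assume t: "t \<in> {0..y}"
    have "norm (f t - ?P t) \<le> C * t powr \<theta>" using exp[of t] t y by auto
    also have "\<dots> \<le> C * y powr \<theta>"
      using t \<theta> C by (intro mult_left_mono powr_mono2) auto
    finally show "norm (f t - ?P t) \<le> C * y powr \<theta>" .
  qed (use P in auto)
  moreover have "integral {0..y} (\<lambda>t. f t - ?P t) = integral {0..y} f - ?Q y"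
    using integral_diff[OF f' has_integral_integrable[OF P]] integral_unique[OF P] by simp
  moreover have "?Q y = (\<Sum>i\<le>Suc k. y ^ i *\<^sub>R (if i = 0 then 0 else d (i - 1) /\<^sub>R real i))"
    by (simp add: sum.atMost_Suc_shift divide_inverse del: sum.atMost_Suc of_nat_Suc)
  ultimately show ?thesis using y by (simp add: powr_add mult_ac)
qed

text \<open>Two descriptions of the same second difference \<open>H\<close> meet here: it is
  asymptotic to \<open>B\<close> times \<open>y powr (a + 1)\<close>, and it is a polynomial of
  degree at most \<open>Suc k\<close>, below \<open>a + 1\<close>, up to a remainder of higher
  order. The coefficients \<open>d x i\<close> are used only at the three nodes, so their dependence
  on \<open>x\<close> may be arbitrary.\<close>

lemma transport_family_normal_derivative_zero:
  fixes u ux uy :: "real \<Rightarrow> real \<Rightarrow> real \<Rightarrow> 'v::euclidean_space" and v :: "real \<Rightarrow> real \<Rightarrow> 'v"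
  assumes a: "a > 0" and \<rho>: "\<rho> > 0"
    and ux: "\<And>l x y. \<lbrakk>l \<in> {0..1}; x \<in> {0..\<rho>}; y \<in> {0..\<rho>}\<rbrakk> \<Longrightarrow>
       ((\<lambda>x. u l x y) has_vector_derivative ux l x y) (at x within {0..\<rho>})"
    and uy: "\<And>l x y. \<lbrakk>l \<in> {0..1}; x \<in> {0..\<rho>}; y \<in> {0..\<rho>}\<rbrakk> \<Longrightarrow>
       (u l x has_vector_derivative uy l x y) (at y within {0..\<rho>})"
    and cont: "\<And>l. l \<in> {0..1} \<Longrightarrow> continuous_on ({0..\<rho>} \<times> {0..\<rho>}) (\<lambda>(x, y). uy l x y)"
    and transport: "\<And>l x y. \<lbrakk>l \<in> {0..1}; x \<in> {0..\<rho>}; y \<in> {0..\<rho>}\<rbrakk> \<Longrightarrow>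
       ux l x y = e - (y powr (a + 1) + l) *\<^sub>R uy l x y"
    and contv: "continuous_on ({0..\<rho>} \<times> {0..\<rho>}) (\<lambda>(x, y). v x y)"
    and quot: "\<And>\<epsilon>. \<epsilon> > 0 \<Longrightarrow> \<forall>\<^sub>F l in at_right 0. \<forall>x\<in>{0..\<rho>}. \<forall>y\<in>{0..\<rho>}.
       norm ((u l x y - u 0 x y) /\<^sub>R l - v x y) \<le> \<epsilon>"
    and k: "real k < a" and \<theta>: "a < \<theta>" and C: "C \<ge> 0"
    and taylor: "\<And>x t. \<lbrakk>x \<in> {0..\<rho>}; t \<in> {0..\<rho>}\<rbrakk> \<Longrightarrow> norm (v x t - (\<Sum>i\<le>k. t ^ i *\<^sub>R d x i)) \<le> C * t powr \<theta>"
  shows "uy 0 0 0 = 0"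
proof -
  define B where "B = (\<rho> / 2)\<^sup>2 *\<^sub>R uy 0 0 0"
  define H where "H = (\<lambda>y. integral {0..y} (v \<rho>) - 2 *\<^sub>R integral {0..y} (v (\<rho> / 2)) + integral {0..y} (v 0))"
  define D where "D = (\<lambda>i. if i = 0 then 0 else (d \<rho> (i - 1) - 2 *\<^sub>R d (\<rho> / 2) (i - 1) + d 0 (i - 1)) /\<^sub>R real i)"
  let ?P = "\<lambda>y. \<Sum>i\<le>Suc k. y ^ i *\<^sub>R D i"
  have limH: "((\<lambda>y. H y /\<^sub>R y powr (a + 1)) \<longlongrightarrow> B) (at_right 0)"
  proof (rule tendstoI)
    fix \<epsilon> :: real assume \<epsilon>: "\<epsilon> > 0"
    then have "\<epsilon> / 2 > 0" by simp
    from limit_second_difference[OF a \<rho> ux uy cont transport contv quot this]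
    obtain \<delta> where \<delta>: "\<delta> > 0" "\<And>y. y \<in> {0<..\<delta>} \<Longrightarrow>
       norm (H y - ((\<rho> / 2)\<^sup>2 * y powr (a + 1)) *\<^sub>R uy 0 0 0) \<le> \<epsilon> / 2 * y powr (a + 1)"
      unfolding H_def by auto
    show "\<forall>\<^sub>F y in at_right 0. dist (H y /\<^sub>R y powr (a + 1)) B < \<epsilon>"
      unfolding eventually_at_right_field
    proof (intro exI[of _ \<delta>] conjI allI impI \<delta>(1))
      fix y assume y: "0 < y" "y < \<delta>"
      have eq: "H y /\<^sub>R y powr (a + 1) - B = (H y - ((\<rho> / 2)\<^sup>2 * y powr (a + 1)) *\<^sub>R uy 0 0 0) /\<^sub>R y powr (a + 1)"
        using y by (simp add: B_def scaleR_diff_right)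
      have "norm (H y /\<^sub>R y powr (a + 1) - B)
          = norm (H y - ((\<rho> / 2)\<^sup>2 * y powr (a + 1)) *\<^sub>R uy 0 0 0) / y powr (a + 1)"
        unfolding eq using y by (intro norm_divideR) simp
      also have "\<dots> \<le> \<epsilon> / 2" using \<delta>(2)[of y] y by (simp add: divide_le_eq)
      finally show "dist (H y /\<^sub>R y powr (a + 1)) B < \<epsilon>" using \<epsilon> by (simp add: dist_norm)
    qed
  qed
  \<comment> \<open>The factor 4 is the sum 1 + 2 + 1 of the absolute weights of the second
    difference.\<close>
  have HP: "norm (H y - ?P y) \<le> 4 * C * y powr (\<theta> + 1)" if y: "y \<in> {0<..\<rho>}" for y
  proof -
    let ?Q = "\<lambda>x. \<Sum>i\<le>Suc k. y ^ i *\<^sub>R (if i = 0 then 0 else d x (i - 1) /\<^sub>R real i)"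
    have q: "norm (integral {0..y} (v x) - ?Q x) \<le> C * y powr (\<theta> + 1)" if x: "x \<in> {0..\<rho>}" for x
    proof (rule integral_polynomial_expansion[OF _ _ C taylor[OF x] y])
      have "continuous_on {0..\<rho>} (\<lambda>y. case (x, y) of (x, y) \<Rightarrow> v x y)"
        by (rule continuous_on_compose2[OF contv]) (use x in \<open>auto intro!: continuous_intros\<close>)
      then show "continuous_on {0..\<rho>} (v x)" by simp
    qed (use a \<theta> in auto)
    have "?P y = ?Q \<rho> - 2 *\<^sub>R ?Q (\<rho> / 2) + ?Q 0"
      unfolding D_def scaleR_sum_right sum_subtractf[symmetric] sum.distrib[symmetric]
      by (intro sum.cong) (auto simp: algebra_simps)
    then have "H y - ?P y = (integral {0..y} (v \<rho>) - ?Q \<rho>) - 2 *\<^sub>R (integral {0..y} (v (\<rho> / 2)) - ?Q (\<rho> / 2))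
       + (integral {0..y} (v 0) - ?Q 0)"
      unfolding H_def by (simp only: scaleR_diff_right) (simp only: algebra_simps)
    moreover have "norm (p - 2 *\<^sub>R q + r) \<le> norm p + 2 * norm q + norm r" for p q r :: 'v
      by norm
    ultimately have "norm (H y - ?P y) \<le> norm (integral {0..y} (v \<rho>) - ?Q \<rho>)
       + 2 * norm (integral {0..y} (v (\<rho> / 2)) - ?Q (\<rho> / 2)) + norm (integral {0..y} (v 0) - ?Q 0)"
      by (simp only:)
    then show ?thesis using q[of \<rho>] q[of "\<rho> / 2"] q[of 0] \<rho> by simp
  qed
  have "((\<lambda>y. H y /\<^sub>R y powr (a + 1) - ?P y /\<^sub>R y powr (a + 1)) \<longlongrightarrow> 0) (at_right 0)"
  proof (rule Lim_null_comparison)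
    show "\<forall>\<^sub>F y in at_right 0. norm (H y /\<^sub>R y powr (a + 1) - ?P y /\<^sub>R y powr (a + 1)) \<le> 4 * C * y powr (\<theta> - a)"
      unfolding eventually_at_right_field
    proof (intro exI[of _ \<rho>] conjI allI impI \<rho>)
      fix y assume y: "0 < y" "y < \<rho>"
      have "norm (H y /\<^sub>R y powr (a + 1) - ?P y /\<^sub>R y powr (a + 1)) = norm (H y - ?P y) / y powr (a + 1)"
        unfolding scaleR_diff_right[symmetric] using y by (intro norm_divideR) simp
      also have "\<dots> \<le> 4 * C * y powr (\<theta> + 1) / y powr (a + 1)"
        using HP[of y] y by (intro divide_right_mono) auto
      also have "\<dots> = 4 * C * y powr (\<theta> - a)"
        using y by (simp add: powr_diff powr_add)
      finally show "norm (H y /\<^sub>R y powr (a + 1) - ?P y /\<^sub>R y powr (a + 1)) \<le> 4 * C * y powr (\<theta> - a)" .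
    qed
    show "((\<lambda>y. 4 * C * y powr (\<theta> - a)) \<longlongrightarrow> 0) (at_right 0)"
      using tendsto_mult_right_zero[OF powr_diff_tendsto_0_at_right[OF \<theta>]] by simp
  qed
  from tendsto_diff[OF limH this]
  have "((\<lambda>y. ?P y /\<^sub>R y powr (a + 1)) \<longlongrightarrow> B) (at_right 0)" by simp
  then have "B = 0"
    using polynomial_not_asymp_noninteger_power[where m = "Suc k" and s = "a + 1" and d = D and B = B] k
    by simp
  then show ?thesis using \<rho> by (simp add: B_def)
qed

section \<open>Hoelder functions on the plane\<close>

lemma holder_norm_finiteD:
  assumes "holder_norm \<alpha> S g < \<infinity>"
  obtains C where "C \<ge> 0" "\<And>x. x \<in> S \<Longrightarrow> norm (g x) \<le> C"
    "\<And>x y. \<lbrakk>\<alpha> \<noteq> 0; x \<in> S; y \<in> S\<rbrakk> \<Longrightarrow> norm (g x - g y) \<le> C * dist x y powr \<alpha>"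
proof -
  obtain C where C: "C \<ge> 0" "holder_norm \<alpha> S g = ennreal C"
    using assms by (cases "holder_norm \<alpha> S g") auto
  show thesis
  proof (rule that[OF C(1)])
    fix x assume x: "x \<in> S"
    have "ennreal (norm (g x)) \<le> (SUP x\<in>S. ennreal (norm (g x)))"
      using x by (intro SUP_upper)
    also have "\<dots> \<le> ennreal C"
      unfolding C(2)[symmetric] holder_norm_def by (rule order_trans[OF _ add_increasing2]) auto
    finally show "norm (g x) \<le> C" using C(1) by simp
  next
    fix x y assume xy: "\<alpha> \<noteq> 0" "x \<in> S" "y \<in> S"
    show "norm (g x - g y) \<le> C * dist x y powr \<alpha>"
    proof (cases "x = y")
      case False
      have "ennreal (norm (g x - g y) / dist x y powr \<alpha>) \<le>
         (SUP (x, y)\<in>{(x, y). x \<in> S \<and> y \<in> S \<and> x \<noteq> y}. ennreal (norm (g x - g y) / dist x y powr \<alpha>))"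
        using xy False by (intro SUP_upper2[of "(x, y)"]) auto
      also have "\<dots> \<le> ennreal C"
        unfolding C(2)[symmetric] holder_norm_def using xy by simp
      finally have "norm (g x - g y) / dist x y powr \<alpha> \<le> C" using C(1) by simp
      then show ?thesis using False by (simp add: divide_le_eq)
    qed auto
  qed
qed

lemma holder_space_differentiable:
  assumes "f \<in> holder_space b D" "open D" "w \<in> multi_dirs (nat \<lfloor>b\<rfloor>)" "length w < nat \<lfloor>b\<rfloor>" "p \<in> D"
  shows "(iter_partial w f has_derivative frechet_derivative (iter_partial w f) (at p)) (at p)"
proof -
  have "iter_partial w f differentiable_on D"
    using assms(1,3,4) unfolding holder_space_def by blast
  then have "iter_partial w f differentiable (at p)"
    using assms(2,5) by (metis at_within_open differentiable_on_def)
  then show ?thesis by (simp add: frechet_derivative_works)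
qed

lemma holder_space_differentiable_at:
  assumes "f \<in> holder_space b D" "open D" "1 \<le> b" "p \<in> D"
  shows "(f has_derivative frechet_derivative f (at p)) (at p)"
  using holder_space_differentiable[of f b D "[]" p] assms by (simp add: multi_dirs_def le_nat_floor)

lemma holder_space_continuous_partial:
  assumes "f \<in> holder_space b D" "w \<in> multi_dirs (nat \<lfloor>b\<rfloor>)"
  shows "continuous_on D (iter_partial w f)"
proof -
  obtain g where "continuous_on (closure D) g" "\<forall>p\<in>D. g p = iter_partial w f p"
    using assms unfolding holder_space_def by blast
  then show ?thesis
    by (metis closure_subset continuous_on_cong continuous_on_subset)
qed

lemma has_derivative_imp_partial_x:
  fixes f :: "real \<times> real \<Rightarrow> 'v::real_normed_vector"
  assumes "(f has_derivative f') (at (x, y))"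
  shows "((\<lambda>x. f (x, y)) has_vector_derivative f' (1, 0)) (at x)"
proof -
  have "((\<lambda>x. (x, y)) has_derivative (\<lambda>h. (h, 0))) (at x)"
    by (auto intro!: derivative_eq_intros)
  from has_derivative_compose[OF this assms]
  have "((\<lambda>x. f (x, y)) has_derivative (\<lambda>h. f' (h, 0))) (at x)" .
  moreover have "(\<lambda>h. f' (h, 0)) = (\<lambda>h. h *\<^sub>R f' (1, 0))"
  proof
    show "f' (h, 0) = h *\<^sub>R f' (1, 0)" for h
      using linear_scale[OF has_derivative_linear[OF assms], of h "(1, 0)"] by simp
  qed
  ultimately show ?thesis by (simp only: has_vector_derivative_def)
qed

lemma has_derivative_imp_partial_y:
  fixes f :: "real \<times> real \<Rightarrow> 'v::real_normed_vector"
  assumes "(f has_derivative f') (at (x, y))"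
  shows "((\<lambda>y. f (x, y)) has_vector_derivative f' (0, 1)) (at y)"
proof -
  have "((\<lambda>y. (x, y)) has_derivative (\<lambda>h. (0, h))) (at y)"
    by (auto intro!: derivative_eq_intros)
  from has_derivative_compose[OF this assms]
  have "((\<lambda>y. f (x, y)) has_derivative (\<lambda>h. f' (0, h))) (at y)" .
  moreover have "(\<lambda>h. f' (0, h)) = (\<lambda>h. h *\<^sub>R f' (0, 1))"
  proof
    show "f' (0, h) = h *\<^sub>R f' (0, 1)" for h
      using linear_scale[OF has_derivative_linear[OF assms], of h "(0, 1)"] by simp
  qed
  ultimately show ?thesis by (simp only: has_vector_derivative_def)
qed

lemma replicate_multi_dirs: "e \<in> Basis \<Longrightarrow> i \<le> k \<Longrightarrow> replicate i e \<in> multi_dirs k"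
  by (auto simp: multi_dirs_def)

lemma of_nat_floor_less:
  fixes a :: real
  assumes "0 \<le> a" "a \<notin> \<nat>"
  shows "real (nat \<lfloor>a\<rfloor>) < a"
  using of_nat_floor[OF assms(1)] assms(2) by (metis of_nat_in_Nats order_le_less)

text \<open>The expansion stops at order \<open>k = nat \<lfloor>a\<rfloor>\<close>, so that its
  degree is below \<open>a\<close>. If \<open>b\<close> has the same integer part, the Hoelder
  seminorm of the derivative of order \<open>k\<close> gives \<open>\<theta> = b\<close>. Otherwise
  the next derivative exists and is bounded on the compact square, so the derivative of order
  \<open>k\<close> is Lipschitz in \<open>t\<close> and \<open>\<theta> = k + 1\<close>, which
  exceeds \<open>a\<close>.\<close>

lemma holder_space_taylor:
  fixes v :: "real \<times> real \<Rightarrow> 'v::euclidean_space"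
  assumes v: "v \<in> holder_space b D" and D: "open D" "{0..\<rho>} \<times> {0..\<rho>} \<subseteq> D"
    and a: "0 \<le> a" "a \<notin> \<nat>" "a < b"
  shows "\<exists>\<theta> C d. a < \<theta> \<and> C \<ge> 0 \<and> (\<forall>x\<in>{0..\<rho>}. \<forall>t\<in>{0..\<rho>}.
     norm (v (x, t) - (\<Sum>i\<le>nat \<lfloor>a\<rfloor>. t ^ i *\<^sub>R d x i)) \<le> C * t powr \<theta>)"
proof -
  define k where "k = nat \<lfloor>a\<rfloor>"
  define f where "f = (\<lambda>x i t. iter_partial (replicate i (0, 1)) v (x, t))"
  have e: "(0, 1) \<in> (Basis :: (real \<times> real) set)" by (auto simp: Basis_prod_def)
  have kb: "k \<le> nat \<lfloor>b\<rfloor>" using a by (auto simp: k_def intro!: nat_mono floor_mono)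
  have ka: "real k < a" "a < real k + 1"
    using of_nat_floor_less[OF a(1,2)] a(1) unfolding k_def by linarith+
  have der: "(f x i has_vector_derivative f x (Suc i) t) (at t)"
    if "i < nat \<lfloor>b\<rfloor>" "x \<in> {0..\<rho>}" "t \<in> {0..\<rho>}" for x i t
  proof -
    have "(iter_partial (replicate i (0, 1)) v has_derivative
        frechet_derivative (iter_partial (replicate i (0, 1)) v) (at (x, t))) (at (x, t))"
      using that D by (intro holder_space_differentiable[OF v] replicate_multi_dirs e) auto
    from has_derivative_imp_partial_y[OF this] show ?thesis
      by (simp add: f_def)
  qed
  obtain C \<sigma> where C: "C \<ge> 0" "\<sigma> > 0" "a < \<sigma> + real k"
    and hold: "\<And>x t. \<lbrakk>x \<in> {0..\<rho>}; t \<in> {0..\<rho>}\<rbrakk> \<Longrightarrow> norm (f x k t - f x k 0) \<le> C * t powr \<sigma>"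
  proof (cases "nat \<lfloor>b\<rfloor> = k")
    case True
    then have fb: "frac b = b - real k" using a by (auto simp: frac_def)
    obtain g where g: "\<forall>p\<in>D. g p = iter_partial (replicate k (0, 1)) v p"
      "holder_norm (frac b) (closure D) g < \<infinity>"
      using v replicate_multi_dirs[OF e kb] unfolding holder_space_def by blast
    obtain C where C: "C \<ge> 0" "\<And>x y. \<lbrakk>frac b \<noteq> 0; x \<in> closure D; y \<in> closure D\<rbrakk> \<Longrightarrow>
       norm (g x - g y) \<le> C * dist x y powr (frac b)"
      using holder_norm_finiteD[OF g(2)] by metis
    show thesis
    proof (rule that[of C "frac b"])
      fix x t assume xt: "x \<in> {0..\<rho>}" "t \<in> {0..\<rho>}"
      then have mem: "(x, t) \<in> D" "(x, 0) \<in> D" using D by auto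
      have "norm (g (x, t) - g (x, 0)) \<le> C * dist (x, t) (x, 0) powr (frac b)"
        using mem closure_subset[of D] fb ka a by (intro C) auto
      then show "norm (f x k t - f x k 0) \<le> C * t powr (frac b)"
        using g(1) mem xt by (simp add: f_def dist_Pair_Pair)
    qed (use C fb ka a in auto)
  next
    case False
    then have k: "Suc k \<le> nat \<lfloor>b\<rfloor>" using kb by auto
    have "continuous_on D (iter_partial (replicate (Suc k) (0, 1)) v)"
      by (intro holder_space_continuous_partial[OF v] replicate_multi_dirs e k)
    then have "bounded (iter_partial (replicate (Suc k) (0, 1)) v ` ({0..\<rho>} \<times> {0..\<rho>}))"
      by (rule compact_imp_bounded[OF compact_continuous_image[OF continuous_on_subset[OF _ D(2)]
          compact_Times[OF compact_Icc compact_Icc]]])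
    then obtain K where K: "\<And>x t. \<lbrakk>x \<in> {0..\<rho>}; t \<in> {0..\<rho>}\<rbrakk> \<Longrightarrow> norm (f x (Suc k) t) \<le> K"
      unfolding bounded_iff f_def by blast
    show thesis
    proof (rule that[of "\<bar>K\<bar>" 1])
      fix x t assume xt: "x \<in> {0..\<rho>}" "t \<in> {0..\<rho>}"
      have "norm (f x k t - f x k 0) \<le> \<bar>K\<bar> * norm (t - 0)"
      proof (rule differentiable_bound[of "{0..\<rho>}" _ "\<lambda>t h. h *\<^sub>R f x (Suc k) t"])
        show "(f x k has_derivative (\<lambda>h. h *\<^sub>R f x (Suc k) s)) (at s within {0..\<rho>})" if "s \<in> {0..\<rho>}" for s
          using has_vector_derivative_at_within[OF der[of k x s]] k xt that
          by (auto simp: has_vector_derivative_def)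
        show "onorm (\<lambda>h. h *\<^sub>R f x (Suc k) s) \<le> \<bar>K\<bar>" if "s \<in> {0..\<rho>}" for s
          using order_trans[OF K[OF xt(1) that] abs_ge_self]
          by (intro onorm_le) (simp add: mult.commute mult_left_mono)
      qed (use xt in auto)
      then show "norm (f x k t - f x k 0) \<le> \<bar>K\<bar> * t powr 1" using xt by auto
    qed (use ka in auto)
  qed
  show ?thesis
  proof (rule exI[of _ "\<sigma> + real k"], rule exI[of _ C], rule exI[of _ "\<lambda>x i. (1 / fact i) *\<^sub>R f x i 0"],
      intro conjI ballI)
    fix x t assume xt: "x \<in> {0..\<rho>}" "t \<in> {0..\<rho>}"
    have eq: "t ^ i *\<^sub>R (1 / fact i) *\<^sub>R f x i 0 = (t ^ i / fact i) *\<^sub>R f x i 0" for i by simp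
    have "norm (f x 0 t - (\<Sum>i\<le>k. (t ^ i / fact i) *\<^sub>R f x i 0)) \<le> C * t powr (\<sigma> + real k)"
    proof (cases "t = 0")
      case False
      then show ?thesis
        using xt kb der C hold by (intro taylor_holder_remainder[where \<rho> = \<rho>]) auto
    next
      case True
      have "(\<Sum>i\<le>k. (0 ^ i / fact i) *\<^sub>R f x i 0) = (\<Sum>i\<le>k. if i = 0 then f x 0 0 else 0)"
        by (intro sum.cong) auto
      then show ?thesis using True by simp
    qed
    then show "norm (v (x, t) - (\<Sum>i\<le>nat \<lfloor>a\<rfloor>. t ^ i *\<^sub>R (1 / fact i) *\<^sub>R f x i 0)) \<le> C * t powr (\<sigma> + real k)"
      unfolding eq k_def[symmetric] by (simp add: f_def)
  qed (use C in auto)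
qed

lemma open_plane_contains_square:
  fixes D :: "(real \<times> real) set"
  assumes "open D" "(0, 0) \<in> D"
  obtains \<rho> where "\<rho> > 0" "{0..\<rho>} \<times> {0..\<rho>} \<subseteq> D"
proof -
  obtain A B where AB: "open A" "open B" "0 \<in> A" "0 \<in> B" "A \<times> B \<subseteq> D"
    using open_prod_elim[OF assms] by (metis mem_Sigma_iff)
  obtain r s where "r > 0" "cball 0 r \<subseteq> A" "s > 0" "cball 0 s \<subseteq> B"
    using AB open_contains_cball by metis
  then show thesis
    using AB by (intro that[of "min r s"]) (auto simp: subset_iff dist_norm)
qed

text \<open>Common core of both nonexistence claims: a family in the plane is restricted to a small
  square with lower left corner at the origin, and linearity of the derivative splits the field into
  its two coordinate parts.\<close>

lemma holder_family_normal_derivative_zero: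
  fixes u :: "real \<Rightarrow> real \<times> real \<Rightarrow> 'v::euclidean_space"
  assumes a: "1 < a" "a \<notin> \<nat>" "a < b" and D: "open D" "(0, 0) \<in> D"
    and u: "\<And>l. l \<in> {0..1} \<Longrightarrow> u l \<in> holder_space b D" and v: "v \<in> holder_space b D"
    and quot: "\<And>\<epsilon>. \<epsilon> > 0 \<Longrightarrow> \<forall>\<^sub>F l in at_right 0. \<forall>p\<in>D. norm ((u l p - u 0 p) /\<^sub>R l - v p) \<le> \<epsilon>"
    and pde: "\<And>l p. \<lbrakk>l \<in> {0..1}; p \<in> D\<rbrakk> \<Longrightarrow> vf_apply (P_field a l) (u l) p = e"
  shows "frechet_derivative (u 0) (at (0, 0)) (0, 1) = 0"
proof -
  obtain \<rho> where \<rho>: "\<rho> > 0" "{0..\<rho>} \<times> {0..\<rho>} \<subseteq> D"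
    using open_plane_contains_square[OF D] .
  have a0: "0 \<le> a" using a by simp
  obtain \<theta> C d where T: "a < \<theta>" "C \<ge> 0" "\<forall>x\<in>{0..\<rho>}. \<forall>t\<in>{0..\<rho>}.
     norm (v (x, t) - (\<Sum>i\<le>nat \<lfloor>a\<rfloor>. t ^ i *\<^sub>R d x i)) \<le> C * t powr \<theta>"
    using holder_space_taylor[OF v D(1) \<rho>(2) a0 a(2,3)] by (elim exE conjE)
  have k: "real (nat \<lfloor>a\<rfloor>) < a"
    using a by (intro of_nat_floor_less) auto
  have b1: "1 \<le> nat \<lfloor>b\<rfloor>" using a by linarith
  have e: "(0, 1) \<in> (Basis :: (real \<times> real) set)" by (auto simp: Basis_prod_def)
  have emp: "[] \<in> multi_dirs n" for n by (simp add: multi_dirs_def)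
  have mem: "(x, y) \<in> D" if "x \<in> {0..\<rho>}" "y \<in> {0..\<rho>}" for x y
    using that \<rho> by auto
  define ux where "ux = (\<lambda>l x y. frechet_derivative (u l) (at (x, y)) (1, 0))"
  define uy where "uy = (\<lambda>l x y. frechet_derivative (u l) (at (x, y)) (0, 1))"
  have der: "(u l has_derivative frechet_derivative (u l) (at p)) (at p)" if "l \<in> {0..1}" "p \<in> D" for l p
    using holder_space_differentiable_at[OF u[OF that(1)] D(1) _ that(2)] a by simp
  have "uy 0 0 0 = 0"
  proof (rule transport_family_normal_derivative_zero[where u = "\<lambda>l x y. u l (x, y)" and ux = ux
        and uy = uy and v = "\<lambda>x y. v (x, y)" and e = e and k = "nat \<lfloor>a\<rfloor>", OF _ \<rho>(1)])
    fix l x y :: real assume l: "l \<in> {0..1}" and x: "x \<in> {0..\<rho>}" and y: "y \<in> {0..\<rho>}"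
    note der' = der[OF l mem[OF x y]]
    show "((\<lambda>x. u l (x, y)) has_vector_derivative ux l x y) (at x within {0..\<rho>})"
      unfolding ux_def by (rule has_vector_derivative_at_within[OF has_derivative_imp_partial_x[OF der']])
    show "((\<lambda>y. u l (x, y)) has_vector_derivative uy l x y) (at y within {0..\<rho>})"
      unfolding uy_def by (rule has_vector_derivative_at_within[OF has_derivative_imp_partial_y[OF der']])
    have "e = frechet_derivative (u l) (at (x, y)) ((1, 0) + (y powr (a + 1) + l) *\<^sub>R (0, 1))"
      using pde[OF l mem[OF x y]] y by (simp add: vf_apply_def P_field_def)
    also have "\<dots> = ux l x y + (y powr (a + 1) + l) *\<^sub>R uy l x y"
      unfolding ux_def uy_def linear_add[OF has_derivative_linear[OF der']]
        linear_scale[OF has_derivative_linear[OF der']] ..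
    finally have "e = ux l x y + (y powr (a + 1) + l) *\<^sub>R uy l x y" .
    then show "ux l x y = e - (y powr (a + 1) + l) *\<^sub>R uy l x y" by simp
  next
    fix l :: real assume l: "l \<in> {0..1}"
    have "continuous_on D (iter_partial (replicate 1 (0, 1)) (u l))"
      by (intro holder_space_continuous_partial[OF u[OF l]] replicate_multi_dirs e b1)
    then have "continuous_on ({0..\<rho>} \<times> {0..\<rho>}) (\<lambda>p. frechet_derivative (u l) (at p) (0, 1))"
      using \<rho>(2) by (simp add: continuous_on_subset)
    then show "continuous_on ({0..\<rho>} \<times> {0..\<rho>}) (\<lambda>(x, y). uy l x y)"
      by (simp add: uy_def case_prod_unfold)
  next
    have "continuous_on D (iter_partial [] v)"
      by (intro holder_space_continuous_partial[OF v] emp)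
    then show "continuous_on ({0..\<rho>} \<times> {0..\<rho>}) (\<lambda>(x, y). v (x, y))"
      using \<rho>(2) by (simp add: continuous_on_subset)
  next
    fix \<epsilon> :: real assume "\<epsilon> > 0"
    from quot[OF this] show "\<forall>\<^sub>F l in at_right 0. \<forall>x\<in>{0..\<rho>}. \<forall>y\<in>{0..\<rho>}.
        norm ((u l (x, y) - u 0 (x, y)) /\<^sub>R l - v (x, y)) \<le> \<epsilon>"
      by eventually_elim (use mem in blast)
  next
    show "norm (v (x, t) - (\<Sum>i\<le>nat \<lfloor>a\<rfloor>. t ^ i *\<^sub>R d x i)) \<le> C * t powr \<theta>"
      if "x \<in> {0..\<rho>}" "t \<in> {0..\<rho>}" for x t
      using T(3) that by blast
  qed (use a k T(1,2) in simp_all)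
  then show ?thesis by (simp add: uy_def)
qed

section \<open>Difference quotients of the two kinds of families\<close>

text \<open>Used with \<open>i = 0\<close> for the members of the family and with
  \<open>i = 1\<close> for the limit \<open>v\<close> of the quotients.\<close>

lemma C_star_slice:
  assumes u: "u \<in> C_star b c D" and i: "i \<le> nat \<lfloor>c\<rfloor>" and l: "l \<in> {0..1}"
  shows "param_deriv i u l \<in> holder_space b D"
proof -
  have slice: "continuous_on (closure D) (g l)"
    if "continuous_on (closure D \<times> {0..1}) (\<lambda>(p, l). g l p)" for g :: "real \<Rightarrow> 'a \<Rightarrow> 'b"
  proof -
    have "continuous_on (closure D) (\<lambda>p. case (p, l) of (p, l) \<Rightarrow> g l p)"
      by (rule continuous_on_compose2[OF that]) (use l in \<open>auto intro!: continuous_intros\<close>)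
    then show ?thesis by simp
  qed
  have "continuous_on (closure D) (param_deriv i u l)"
    using u i unfolding C_star_def by (intro slice) blast
  moreover have "iter_partial w (param_deriv i u l) differentiable_on D"
    if "w \<in> multi_dirs (nat \<lfloor>b\<rfloor>)" "length w < nat \<lfloor>b\<rfloor>" for w
    using u i l that unfolding C_star_def by blast
  moreover have "\<exists>g. continuous_on (closure D) g \<and> (\<forall>p\<in>D. g p = iter_partial w (param_deriv i u l) p) \<and>
        holder_norm (frac b) (closure D) g < \<infinity>"
    if "w \<in> multi_dirs (nat \<lfloor>b\<rfloor>)" for w
  proof -
    have "\<exists>g. continuous_on (closure D \<times> {0..1}) (\<lambda>(p, l). g l p) \<and>
        (\<forall>l\<in>{0..1}. \<forall>p\<in>D. g l p = iter_partial w (param_deriv i u l) p) \<and>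
        (\<exists>C. \<forall>l\<in>{0..1}. holder_norm (frac b) (closure D) (g l) \<le> ennreal C) \<and>
        (\<exists>C. \<forall>p\<in>closure D. holder_norm (frac c) {0..1} (\<lambda>l. g l p) \<le> ennreal C)"
      using u i that unfolding C_star_def by simp
    then obtain g C where g: "continuous_on (closure D \<times> {0..1}) (\<lambda>(p, l). g l p)"
      "\<forall>l\<in>{0..1}. \<forall>p\<in>D. g l p = iter_partial w (param_deriv i u l) p"
      and C: "\<forall>l\<in>{0..1}. holder_norm (frac b) (closure D) (g l) \<le> ennreal C"
      by (elim exE conjE)
    have "holder_norm (frac b) (closure D) (g l) < \<infinity>"
      using le_less_trans[OF C[rule_format, OF l] ennreal_less_top] by simp
    then show ?thesis using g l slice[OF g(1)] by blast
  qed
  ultimately show ?thesis unfolding holder_space_def by blast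
qed

text \<open>Boundedness of \<open>D\<close> makes \<open>closure D \<times> {0..1}\<close> compact,
  so the parameter derivative is uniformly continuous there; the mean value inequality in the
  parameter then gives a bound uniform in \<open>p\<close>.\<close>

lemma C_star_difference_quotient:
  fixes u :: "real \<Rightarrow> 'a::euclidean_space \<Rightarrow> 'b::real_normed_vector"
  assumes u: "u \<in> C_star b 1 D" and D: "bounded D" and \<epsilon>: "\<epsilon> > 0"
  shows "\<forall>\<^sub>F l in at_right 0. \<forall>p\<in>D. norm ((u l p - u 0 p) /\<^sub>R l - param_deriv 1 u 0 p) \<le> \<epsilon>"
proof -
  let ?v = "param_deriv 1 u"
  have diff: "((\<lambda>s. u s p) has_vector_derivative ?v l p) (at l within {0..1})"
    if "p \<in> closure D" "l \<in> {0..1}" for p l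
  proof -
    have "(\<lambda>s. param_deriv 0 u s p) differentiable (at l within {0..1})"
      using u that unfolding C_star_def by auto
    then show ?thesis by (simp add: vector_derivative_works)
  qed
  have cont: "continuous_on (closure D \<times> {0..1}) (\<lambda>(p, l). ?v l p)"
    using u unfolding C_star_def by auto
  have "compact (closure D \<times> {0..1::real})"
    using D by (intro compact_Times) auto
  from compact_uniformly_continuous[OF cont this]
  obtain \<delta> where \<delta>: "\<delta> > 0" "\<And>x y. \<lbrakk>x \<in> closure D \<times> {0..1}; y \<in> closure D \<times> {0..1}; dist y x < \<delta>\<rbrakk> \<Longrightarrow>
       dist (case y of (p, l) \<Rightarrow> ?v l p) (case x of (p, l) \<Rightarrow> ?v l p) < \<epsilon>"
    unfolding uniformly_continuous_on_def using \<epsilon> by metis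
  show ?thesis
    unfolding eventually_at_right_field
  proof (intro exI[of _ "min 1 \<delta>"] conjI allI impI ballI)
    fix l p assume l: "0 < l" "l < min 1 \<delta>" and p: "p \<in> D"
    have pc: "p \<in> closure D" using p closure_subset by blast
    have "norm (u l p - u 0 p - (l - 0) *\<^sub>R ?v 0 p) \<le> norm (l - 0) * \<epsilon>"
    proof (rule vector_differentiable_bound_linearization[where S = "{0..l}"])
      show "((\<lambda>s. u s p) has_vector_derivative ?v s p) (at s within {0..l})" if "s \<in> {0..l}" for s
        using that l by (intro has_vector_derivative_within_subset[OF diff[OF pc]]) auto
      show "norm (?v s p - ?v 0 p) \<le> \<epsilon>" if "s \<in> {0..l}" for s
        using \<delta>(2)[of "(p, 0)" "(p, s)"] that l pc by (auto simp: dist_Pair_Pair dist_norm)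
    qed (use l in \<open>auto simp: closed_segment_eq_real_ivl\<close>)
    moreover have "(u l p - u 0 p) /\<^sub>R l - ?v 0 p = (u l p - u 0 p - (l - 0) *\<^sub>R ?v 0 p) /\<^sub>R l"
      using l by (simp add: scaleR_diff_right)
    ultimately show "norm ((u l p - u 0 p) /\<^sub>R l - ?v 0 p) \<le> \<epsilon>"
      using l by (simp only: norm_divideR) (simp add: divide_le_eq mult.commute)
  qed (use \<delta> in auto)
qed

lemma norm_le_holder_space_norm:
  assumes "p \<in> D"
  shows "ennreal (norm (f p)) \<le> holder_space_norm b D f"
proof -
  have "ennreal (norm (f p)) \<le> (SUP x\<in>D. ennreal (norm (f x)))"
    using assms by (intro SUP_upper)
  also have "\<dots> \<le> holder_norm (frac b) D f"
    unfolding holder_norm_def by (rule add_increasing2) auto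
  also have "\<dots> = holder_norm (frac b) D (iter_partial [] f)" by simp
  also have "\<dots> \<le> holder_space_norm b D f"
    unfolding holder_space_norm_def by (intro SUP_upper) (simp add: multi_dirs_def)
  finally show ?thesis .
qed

lemma holder_space_bounded:
  assumes "f \<in> holder_space b D"
  obtains K where "K \<ge> 0" "\<And>p. p \<in> D \<Longrightarrow> norm (f p) \<le> K"
proof -
  have "[] \<in> multi_dirs (nat \<lfloor>b\<rfloor>)" by (simp add: multi_dirs_def)
  then obtain g where g: "\<forall>p\<in>D. g p = iter_partial [] f p" "holder_norm (frac b) (closure D) g < \<infinity>"
    using assms unfolding holder_space_def by blast
  obtain K where K: "K \<ge> 0" "\<And>p. p \<in> closure D \<Longrightarrow> norm (g p) \<le> K"
    using holder_norm_finiteD[OF g(2)] by metis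
  show thesis
  proof (rule that[OF K(1)])
    show "norm (f p) \<le> K" if "p \<in> D" for p
      using K(2)[of p] g(1) that closure_subset[of D] by auto
  qed
qed

text \<open>The limit is the linear coefficient \<open>c 1\<close> of the power series at 0. The
  convergence assumed for each single \<open>l\<close> is uniform in \<open>p\<close> but not in
  \<open>l\<close>. Uniformity near 0 comes as in Abel's lemma: boundedness of the terms at one
  parameter \<open>s\<close> gives a geometric majorant for smaller ones.\<close>

lemma analytic_family_difference_quotient:
  assumes F: "analytic_family b D F"
  obtains v where "v \<in> holder_space b D"
    "\<And>\<epsilon>. \<epsilon> > 0 \<Longrightarrow> \<forall>\<^sub>F l in at_right 0. \<forall>p\<in>D. norm ((F l p - F 0 p) /\<^sub>R l - v p) \<le> \<epsilon>"
proof -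
  have "(0::real) \<in> {0..1}" by simp
  then obtain r c where r: "r > 0" and c: "\<And>n. c n \<in> holder_space b D"
    and lim0: "\<forall>l\<in>{0..1}. \<bar>l - 0\<bar> < r \<longrightarrow>
       (\<lambda>n. holder_space_norm b D (\<lambda>p. F l p - (\<Sum>i<n. (l - 0) ^ i *\<^sub>R c i p))) \<longlonglongrightarrow> 0"
    using F unfolding analytic_family_def by blast
  define S where "S = (\<lambda>n l p. \<Sum>i<n. l ^ i *\<^sub>R c i p)"
  have unif: "\<forall>\<^sub>F n in sequentially. \<forall>p\<in>D. norm (F l p - S n l p) < \<epsilon>"
    if "l \<in> {0..1}" "l < r" "\<epsilon> > 0" for l \<epsilon>
  proof -
    have "(\<lambda>n. holder_space_norm b D (\<lambda>p. F l p - S n l p)) \<longlonglongrightarrow> 0"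
      using lim0 that unfolding S_def by auto
    then have "\<forall>\<^sub>F n in sequentially. holder_space_norm b D (\<lambda>p. F l p - S n l p) < ennreal \<epsilon>"
      using that by (intro order_tendstoD) auto
    then show ?thesis
    proof eventually_elim
      case (elim n)
      show ?case
      proof
        fix p assume "p \<in> D"
        then have "ennreal (norm (F l p - S n l p)) < ennreal \<epsilon>"
          using le_less_trans[OF norm_le_holder_space_norm[of p D "\<lambda>p. F l p - S n l p" b] elim] by simp
        then show "norm (F l p - S n l p) < \<epsilon>" by (simp add: ennreal_less_iff)
      qed
    qed
  qed
  have ptw: "(\<lambda>n. S n l p) \<longlonglongrightarrow> F l p" if "l \<in> {0..1}" "l < r" "p \<in> D" for l p
  proof (rule tendstoI)
    fix \<epsilon> :: real assume "\<epsilon> > 0"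
    from unif[OF that(1,2) this] show "\<forall>\<^sub>F n in sequentially. dist (S n l p) (F l p) < \<epsilon>"
      by eventually_elim (use that in \<open>auto simp: dist_norm norm_minus_commute\<close>)
  qed
  have F0: "F 0 p = c 0 p" if "p \<in> D" for p
  proof -
    have "S (Suc n) 0 p = c 0 p" for n
      by (simp add: S_def sum.lessThan_Suc_shift del: sum.lessThan_Suc)
    moreover have "(\<lambda>n. S (Suc n) 0 p) \<longlonglongrightarrow> F 0 p"
      using LIMSEQ_Suc[OF ptw[of 0 p]] r that by simp
    ultimately show ?thesis by (simp add: LIMSEQ_const_iff)
  qed
  \<comment> \<open>This point lies both in the parameter interval and strictly inside the radius of
    convergence.\<close>
  define s where "s = min 1 (r / 2)"
  have s: "0 < s" "s \<le> 1" "s < r" using r by (auto simp: s_def)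
  \<comment> \<open>From some \<open>N\<close> on, consecutive partial sums are within 1 of
    \<open>F s\<close>, so their difference, a single term, is at most 2. The finitely many earlier
    terms have bounds of their own, which are summed.\<close>
  obtain M where M: "M \<ge> 0" "\<And>n p. p \<in> D \<Longrightarrow> s ^ n * norm (c n p) \<le> M"
  proof -
    obtain N where N: "\<And>n p. \<lbrakk>n \<ge> N; p \<in> D\<rbrakk> \<Longrightarrow> norm (F s p - S n s p) < 1"
      using unif[of s 1] s unfolding eventually_sequentially by auto
    have "\<forall>n. \<exists>K. K \<ge> 0 \<and> (\<forall>p\<in>D. norm (c n p) \<le> K)"
      using holder_space_bounded[OF c] by (metis (no_types))
    then obtain K where K: "\<And>n. K n \<ge> 0" "\<And>n p. p \<in> D \<Longrightarrow> norm (c n p) \<le> K n"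
      by metis
    show thesis
    proof (rule that[of "2 + (\<Sum>n<N. K n)"])
      show "0 \<le> 2 + (\<Sum>n<N. K n)" using K by (simp add: sum_nonneg)
      fix n p assume p: "p \<in> D"
      show "s ^ n * norm (c n p) \<le> 2 + (\<Sum>n<N. K n)"
      proof (cases "n < N")
        case True
        have "s ^ n * norm (c n p) \<le> 1 * K n"
          using s K p by (intro mult_mono power_le_one) auto
        also have "\<dots> \<le> (\<Sum>n<N. K n)"
          using True K by (auto intro: member_le_sum)
        finally show ?thesis by simp
      next
        case False
        have "s ^ n *\<^sub>R c n p = (F s p - S n s p) - (F s p - S (Suc n) s p)"
          by (simp add: S_def)
        then have "norm (s ^ n *\<^sub>R c n p) \<le> norm (F s p - S n s p) + norm (F s p - S (Suc n) s p)"
          by (metis norm_triangle_ineq4)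
        then have "s ^ n * norm (c n p) \<le> 2"
          using N[of n p] N[of "Suc n" p] False p s by simp
        then show ?thesis using K by (simp add: add_increasing2 sum_nonneg)
      qed
    qed
  qed
  \<comment> \<open>The terms of order at least 2 have ratio \<open>l / s \<le> 1 / 2\<close> in
    their majorant, so they sum to at most twice the first bound.\<close>
  have remainder: "norm (F l p - F 0 p - l *\<^sub>R c 1 p) \<le> 2 * M * (l / s)\<^sup>2"
    if l: "0 < l" "l \<le> s / 2" and p: "p \<in> D" for l p
  proof (rule tendsto_upperbound)
    have "(\<lambda>n. S (Suc (Suc n)) l p) \<longlonglongrightarrow> F l p"
      using LIMSEQ_Suc[OF LIMSEQ_Suc[OF ptw[of l p]]] l s p by simp
    then show "(\<lambda>n. norm (S (Suc (Suc n)) l p - F 0 p - l *\<^sub>R c 1 p)) \<longlonglongrightarrow> norm (F l p - F 0 p - l *\<^sub>R c 1 p)"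
      by (intro tendsto_intros)
    have "norm (S (Suc (Suc n)) l p - F 0 p - l *\<^sub>R c 1 p) \<le> 2 * M * (l / s)\<^sup>2" for n
    proof -
      have "S (Suc (Suc n)) l p - F 0 p - l *\<^sub>R c 1 p = (\<Sum>i<n. l ^ Suc (Suc i) *\<^sub>R c (Suc (Suc i)) p)"
        using p by (simp add: S_def F0 sum.lessThan_Suc_shift del: sum.lessThan_Suc)
      also have "norm \<dots> \<le> (\<Sum>i<n. M * (l / s)\<^sup>2 * (1 / 2) ^ i)"
      proof (rule sum_norm_le)
        fix i
        have "norm (l ^ Suc (Suc i) *\<^sub>R c (Suc (Suc i)) p)
            = (l / s) ^ Suc (Suc i) * (s ^ Suc (Suc i) * norm (c (Suc (Suc i)) p))"
          using l s by (simp add: power_divide)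
        also have "\<dots> \<le> (l / s) ^ Suc (Suc i) * M"
          using l s by (intro mult_left_mono M p) auto
        also have "\<dots> = M * (l / s)\<^sup>2 * (l / s) ^ i"
          by (simp add: power2_eq_square)
        also have "\<dots> \<le> M * (l / s)\<^sup>2 * (1 / 2) ^ i"
          using l s M(1) by (intro mult_left_mono power_mono) (auto simp: field_simps)
        finally show "norm (l ^ Suc (Suc i) *\<^sub>R c (Suc (Suc i)) p) \<le> M * (l / s)\<^sup>2 * (1 / 2) ^ i" .
      qed
      also have "\<dots> = M * (l / s)\<^sup>2 * (\<Sum>i<n. (1 / 2) ^ i)"
        by (simp add: sum_distrib_left)
      also have "\<dots> \<le> M * (l / s)\<^sup>2 * 2"
      proof (rule mult_left_mono)
        have "(\<Sum>i<n. (1 / 2 :: real) ^ i) = 2 - 2 * (1 / 2) ^ n"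
          by (induction n) auto
        then show "(\<Sum>i<n. (1 / 2 :: real) ^ i) \<le> 2" by simp
      qed (use M in auto)
      finally show ?thesis by (simp add: mult_ac)
    qed
    then show "\<forall>\<^sub>F n in sequentially. norm (S (Suc (Suc n)) l p - F 0 p - l *\<^sub>R c 1 p) \<le> 2 * M * (l / s)\<^sup>2"
      by simp
  qed simp
  show thesis
  proof (rule that[OF c[of 1]])
    fix \<epsilon> :: real assume \<epsilon>: "\<epsilon> > 0"
    show "\<forall>\<^sub>F l in at_right 0. \<forall>p\<in>D. norm ((F l p - F 0 p) /\<^sub>R l - c 1 p) \<le> \<epsilon>"
      unfolding eventually_at_right_field
    \<comment> \<open>The remainder divided by \<open>l\<close> is at most
      \<open>2 * M * l / s\<^sup>2\<close>; the \<open>+ 1\<close> keeps the denominator positive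
      when \<open>M = 0\<close>.\<close>
    proof (intro exI[of _ "min (s / 2) (\<epsilon> * s\<^sup>2 / (2 * M + 1))"] conjI allI impI ballI)
      show "0 < min (s / 2) (\<epsilon> * s\<^sup>2 / (2 * M + 1))" using s \<epsilon> M(1) by simp
      fix l p assume l: "0 < l" "l < min (s / 2) (\<epsilon> * s\<^sup>2 / (2 * M + 1))" and p: "p \<in> D"
      have "(F l p - F 0 p) /\<^sub>R l - c 1 p = (F l p - F 0 p - l *\<^sub>R c 1 p) /\<^sub>R l"
        using l by (simp add: scaleR_diff_right)
      then have "norm ((F l p - F 0 p) /\<^sub>R l - c 1 p) = norm (F l p - F 0 p - l *\<^sub>R c 1 p) / l"
        using l by (simp only: norm_divideR)
      also have "\<dots> \<le> 2 * M * (l / s)\<^sup>2 / l"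
        using remainder[of l p] l p by (intro divide_right_mono) auto
      also have "\<dots> = 2 * M * l / s\<^sup>2"
        using l by (simp add: power2_eq_square)
      also have "\<dots> \<le> (2 * M + 1) * l / s\<^sup>2"
        using l by (intro divide_right_mono mult_right_mono) auto
      also have "\<dots> \<le> \<epsilon>"
        using l s M(1) by (simp add: field_simps)
      finally show "norm ((F l p - F 0 p) /\<^sub>R l - c 1 p) \<le> \<epsilon>" .
    qed
  qed
qed

text \<open>The type class of the values of \<open>N\<close> admits both real and complex solutions.
  In the first part the vanishing normal derivative and the equation at the origin annihilate the
  whole differential; in the second the vanishing normal derivative already contradicts the
  differentiability of the inverse map.\<close>

theorem proposition4p6:
  fixes a :: real
  assumes "1 < a" and "a \<notin> \<nat>"
  shows
    "(\<nexists>(b::real) (D::(real \<times> real) set)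
         (N::real \<Rightarrow> real \<times> real \<Rightarrow> 'v::{real_normed_field, euclidean_space}).
        b > a \<and> bounded_domain D \<and> (0, 0) \<in> D \<and> N \<in> C_star b 1 D \<and>
        (\<forall>l\<in>{0..1}. \<forall>p\<in>D. vf_apply (P_field a l) (N l) p = 0) \<and>
        (\<forall>l\<in>{0..1}. frechet_derivative (N l) (at (0, 0)) \<noteq> (\<lambda>v. 0)))
     \<and>
     (\<nexists>(b::real) (D::(real \<times> real) set) (F::real \<Rightarrow> real \<times> real \<Rightarrow> real \<times> real).
        b > a \<and> bounded_domain D \<and> (0, 0) \<in> D \<and>
        analytic_family b D F \<and>
        (\<forall>l\<in>{0..1}. holder_diffeo b D (F l)) \<and>
        (\<forall>l\<in>{0..1}. \<forall>q\<in>F l ` D. pushforward D (F l) (P_field a l) q = (1, 0)))"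
proof (intro conjI notI; elim exE conjE)
  fix b :: real and D :: "(real \<times> real) set" and N :: "real \<Rightarrow> real \<times> real \<Rightarrow> 'v"
  assume b: "a < b" and D: "bounded_domain D" "(0, 0) \<in> D" and N: "N \<in> C_star b 1 D"
    and pde: "\<forall>l\<in>{0..1}. \<forall>p\<in>D. vf_apply (P_field a l) (N l) p = 0"
    and nz: "\<forall>l\<in>{0..1}. frechet_derivative (N l) (at (0, 0)) \<noteq> (\<lambda>v. 0)"
  let ?N' = "frechet_derivative (N 0) (at (0, 0))"
  have D': "open D" "bounded D" using D by (auto simp: bounded_domain_def)
  have sp: "N l \<in> holder_space b D" if "l \<in> {0..1}" for l
    using C_star_slice[OF N, of 0 l] that by simp
  have y: "?N' (0, 1) = 0"
    using C_star_slice[OF N, of 1 0] C_star_difference_quotient[OF N D'(2)] pde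
    by (intro holder_family_normal_derivative_zero[OF assms b D'(1) D(2) sp]) auto
  \<comment> \<open>At the origin and parameter 0 the field is the first coordinate field, as
    \<open>0 powr (a + 1) = 0\<close>.\<close>
  have x: "?N' (1, 0) = 0"
    using pde[rule_format, of 0 "(0, 0)"] D(2) by (simp add: vf_apply_def P_field_def)
  have "(N 0 has_derivative ?N') (at (0, 0))"
    using holder_space_differentiable_at[OF sp D'(1) _ D(2)] b assms(1) by simp
  then have lin: "linear ?N'" by (rule has_derivative_linear)
  have "?N' v = 0" for v
  proof -
    have "v = fst v *\<^sub>R (1, 0) + snd v *\<^sub>R (0, 1)" by (simp add: prod_eq_iff)
    then have "?N' v = ?N' (fst v *\<^sub>R (1, 0) + snd v *\<^sub>R (0, 1))" by (rule arg_cong)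
    also have "\<dots> = 0" unfolding linear_add[OF lin] linear_scale[OF lin] x y by simp
    finally show ?thesis .
  qed
  then have "?N' = (\<lambda>v. 0)" by blast
  then show False using nz by simp
next
  fix b :: real and D :: "(real \<times> real) set" and F :: "real \<Rightarrow> real \<times> real \<Rightarrow> real \<times> real"
  assume b: "a < b" and D: "bounded_domain D" "(0, 0) \<in> D" and F: "analytic_family b D F"
    and diffeo: "\<forall>l\<in>{0..1}. holder_diffeo b D (F l)"
    and push: "\<forall>l\<in>{0..1}. \<forall>q\<in>F l ` D. pushforward D (F l) (P_field a l) q = (1, 0)"
  let ?F' = "frechet_derivative (F 0) (at (0, 0))" and ?G = "inv_into D (F 0)" and ?q = "F 0 (0, 0)"
  have D': "open D" using D by (auto simp: bounded_domain_def)
  have b1: "1 \<le> b" using b assms(1) by simp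
  have sp: "F l \<in> holder_space b D" if "l \<in> {0..1}" for l
    using F that unfolding analytic_family_def by blast
  obtain v where v: "v \<in> holder_space b D"
    "\<And>\<epsilon>. \<epsilon> > 0 \<Longrightarrow> \<forall>\<^sub>F l in at_right 0. \<forall>p\<in>D. norm ((F l p - F 0 p) /\<^sub>R l - v p) \<le> \<epsilon>"
    using analytic_family_difference_quotient[OF F] by blast
  have pde: "vf_apply (P_field a l) (F l) p = (1, 0)" if "l \<in> {0..1}" "p \<in> D" for l p
  proof -
    have "inj_on (F l) D" using diffeo that unfolding holder_diffeo_def by blast
    then show ?thesis
      using push[rule_format, OF that(1) imageI[OF that(2)]] that
      by (simp add: pushforward_def)
  qed
  have F'0: "?F' (0, 1) = 0"
    by (rule holder_family_normal_derivative_zero[OF assms b D' D(2) sp v pde])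
  have inj: "inj_on (F 0) D" and G: "locally_holder b (F 0 ` D) ?G"
    using diffeo unfolding holder_diffeo_def by auto
  obtain r where r: "r > 0" "?G \<in> holder_space b (ball ?q r)"
    using G D(2) unfolding locally_holder_def by blast
  have G': "(?G has_derivative frechet_derivative ?G (at ?q)) (at ?q)"
    using holder_space_differentiable_at[OF r(2) open_ball b1] r(1) by simp
  have "(F 0 has_derivative ?F') (at (0, 0))"
    using holder_space_differentiable_at[OF sp D' b1 D(2)] by simp
  from has_derivative_compose[OF this G']
  have "((\<lambda>p. ?G (F 0 p)) has_derivative (\<lambda>h. frechet_derivative ?G (at ?q) (?F' h))) (at (0, 0))" .
  \<comment> \<open>The inverse composed with \<open>F 0\<close> is the identity on the open set
    \<open>D\<close>, so by uniqueness this composition of derivatives is the identity, although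
    \<open>?F'\<close> kills \<open>(0, 1)\<close>.\<close>
  then have "((\<lambda>p. p) has_derivative (\<lambda>h. frechet_derivative ?G (at ?q) (?F' h))) (at (0, 0))"
    by (rule has_derivative_transform_within_open[OF _ D' D(2)]) (use inj in simp)
  from has_derivative_unique[OF this has_derivative_ident]
  have "frechet_derivative ?G (at ?q) (?F' (0, 1)) = (0, 1)" by meson
  moreover have "frechet_derivative ?G (at ?q) 0 = 0"
    by (rule linear_0[OF has_derivative_linear[OF G']])
  ultimately show False using F'0 by (simp add: zero_prod_def)
qed

end
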